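(* Let $k\ge2$. Grow random $k$-Stirling permutations by the random insertion process described in the context, and let $K_{n,1}\ge K_{n,2}\ge\cdots$ be the block sizes of the permutation of order $n$ in decreasing order (padded with zeros). Then \[ \frac1{kn}(K_{n,1},K_{n,2},\dots)\xrightarrow{a.s.}(V_1,V_2,\dots), \] where $(V_1,V_2,\dots)$ has the Poisson–Dirichlet distribution $\mathrm{PD}(\frac1k,\frac1k)$ (convergence componentwise, equivalently in $\ell^1$).
   Context: A $k$-Stirling permutation of order $n$ is a word $a_1\cdots a_{kn}$ in which each of $1,\dots,n$ occurs exactly $k$ times, such that for each $i$ every entry between two occurrences of $i$ is at least $i$. A block is a substring $a_p\cdots a_q$ ($p\le q$) with $a_p=a_q$ not contained in any strictly larger such substring; the block sizes sum to $kn$. Growth process: start with $1^k$; given a permutation of order $n$, insert the string $(n+1)^k$ into one of its $kn+1$ gaps (including first and last positions) chosen uniformly at random. $\mathrm{PD}(\frac1k,\frac1k)$ is the law of the decreasing rearrangement $(V_i)_{i\ge1}$ of $(\tilde V_i)_{i\ge1}$, where $\tilde V_i=\beta_i\prod_{j=1}^{i-1}(1-\beta_j)$ and the $\beta_i\sim\mathrm{Beta}\bigl(\frac{k-1}{k},\frac{i+1}{k}\bigr)$ are independent. *)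

theory Defs
  imports "HOL-Probability.Probability" "HOL-Library.Multiset"
begin

section \<open>Stirling permutations and their blocks\<close>

definition stirling_perm :: "nat \<Rightarrow> nat \<Rightarrow> nat list \<Rightarrow> bool" where
  "stirling_perm k n w \<longleftrightarrow>
     set w \<subseteq> {1..n} \<and> (\<forall>i\<in>{1..n}. count_list w i = k) \<and>
     (\<forall>p q r. p < q \<longrightarrow> q < r \<longrightarrow> r < length w \<longrightarrow> w ! p = w ! r \<longrightarrow> w ! p \<le> w ! q)"

text \<open>A word of length \<open>l\<close> has the \<open>l + 1\<close> gaps \<open>0, \<dots>, l\<close>; gap \<open>g\<close> follows the first \<open>g\<close> letters.\<close>

definition insert_string :: "nat \<Rightarrow> 'a list \<Rightarrow> 'a list \<Rightarrow> 'a list" where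
  "insert_string g u w = take g w @ u @ drop g w"

text \<open>Substrings are represented by the (0-based) positions of their first and last letters.\<close>

definition equal_end_substrings :: "'a list \<Rightarrow> (nat \<times> nat) set" where
  "equal_end_substrings w = {(p, q). p \<le> q \<and> q < length w \<and> w ! p = w ! q}"

definition blocks :: "'a list \<Rightarrow> (nat \<times> nat) set" where
  "blocks w = {(p, q) \<in> equal_end_substrings w.
     \<not> (\<exists>(p', q') \<in> equal_end_substrings w. {p..q} \<subset> {p'..q'})}"

definition block_sizes :: "'a list \<Rightarrow> nat multiset" where
  "block_sizes w = image_mset (\<lambda>(p, q). q - p + 1) (mset_set (blocks w))"

text \<open>\<open>ranked_block_size w i\<close> is the \<open>(i + 1)\<close>-st largest block size, \<open>0\<close> if there are at most
  \<open>i\<close> blocks.\<close>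

definition ranked_block_size :: "'a list \<Rightarrow> nat \<Rightarrow> nat" where
  "ranked_block_size w i =
     (let s = rev (sorted_list_of_multiset (block_sizes w)) in if i < length s then s ! i else 0)"

lemma stirling_perm_start: "stirling_perm k 1 (replicate k 1)"
proof -
  have "count_list (replicate k (1::nat)) 1 = k" by (induction k) auto
  then show ?thesis by (auto simp: stirling_perm_def)
qed

lemma stirling_perm_insert_string:
  assumes w: "stirling_perm k n w" and g: "g \<le> length w"
  shows "stirling_perm k (Suc n) (insert_string g (replicate k (Suc n)) w)"
proof -
  let ?w = "insert_string g (replicate k (Suc n)) w"
  have le: "w ! p \<le> n" if "p < length w" for p
    using w nth_mem[OF that] by (auto simp: stirling_perm_def dest!: subsetD[of "set w"])
  have ord: "w ! p \<le> w ! q" if "p < q" "q < r" "r < length w" "w ! p = w ! r" for p q r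
    using w that unfolding stirling_perm_def by blast
  have nth: "?w ! p = (if p < g then w ! p else if p < g + k then Suc n else w ! (p - k))"
    if "p < length w + k" for p
    using that g by (auto simp: insert_string_def nth_append min_def)
  have len: "length ?w = length w + k" using g by (simp add: insert_string_def)
  have cr: "count_list (replicate k (Suc n)) i = (if i = Suc n then k else 0)" for i
    by (induction k) auto
  have ct: "count_list ?w i = count_list w i + (if i = Suc n then k else 0)" for i
  proof -
    have "count_list w i = count_list (take g w) i + count_list (drop g w) i"
      by (metis append_take_drop_id count_list_append)
    then show ?thesis by (simp add: insert_string_def count_list_append cr)
  qed
  have "set ?w \<subseteq> {1..Suc n}"
    using w set_take_subset[of g w] set_drop_subset[of g w]
    by (fastforce simp: insert_string_def stirling_perm_def)
  moreover have "\<forall>i\<in>{1..Suc n}. count_list ?w i = k"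
  proof
    fix i assume i: "i \<in> {1..Suc n}"
    have "count_list w (Suc n) = 0"
      using w by (auto simp: stirling_perm_def count_list_0_iff)
    then show "count_list ?w i = k"
      using w i unfolding ct by (cases "i = Suc n") (auto simp: stirling_perm_def)
  qed
  moreover have "?w ! p \<le> ?w ! q"
    if pqr: "p < q" "q < r" "r < length ?w" "?w ! p = ?w ! r" for p q r
  proof -
    have r: "r < length w + k" using pqr len by simp
    define f where "f = (\<lambda>p. if p < g then p else p - k)"
    have in_w: "?w ! x = w ! f x" "f x < length w" if "\<not> (g \<le> x \<and> x < g + k)" "x \<le> r" for x
      using that r g by (auto simp: nth f_def)
    have new: "?w ! x = Suc n" if "g \<le> x \<and> x < g + k" for x
      using that g by (simp add: nth)
    show ?thesis
    proof (cases "g \<le> q \<and> q < g + k")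
      case True
      then show ?thesis
        using new[of q] new[of p] in_w[of p] le[of "f p"] pqr
        by (cases "g \<le> p \<and> p < g + k") auto
    next
      case q: False
      show ?thesis
      proof (cases "g \<le> p \<and> p < g + k")
        case True
        have "\<not> (g \<le> r \<and> r < g + k)" using True q pqr by auto
        then show ?thesis using new[OF True] in_w[of r] le[of "f r"] pqr by auto
      next
        case p: False
        have rr: "\<not> (g \<le> r \<and> r < g + k)"
        proof
          assume "g \<le> r \<and> r < g + k"
          then show False using new[of r] in_w[of p] p le[of "f p"] pqr by auto
        qed
        have "f p < f q" "f q < f r" using p q rr pqr by (auto simp: f_def)
        then show ?thesis using in_w[of p] in_w[of q] in_w[of r] p q rr pqr ord[of "f p" "f q" "f r"]
          by auto
      qed
    qed
  qed
  ultimately show ?thesis unfolding stirling_perm_def by blast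
qed

section \<open>Poisson-Dirichlet distributions\<close>

definition beta_density :: "real \<Rightarrow> real \<Rightarrow> real \<Rightarrow> real" where
  "beta_density a b x =
     (if 0 < x \<and> x < 1 then x powr (a - 1) * (1 - x) powr (b - 1) / Beta a b else 0)"

definition beta_distribution :: "real \<Rightarrow> real \<Rightarrow> real measure" where
  "beta_distribution a b = density lborel (\<lambda>x. ennreal (beta_density a b x))"

definition stick_breaking :: "(nat \<Rightarrow> real) \<Rightarrow> nat \<Rightarrow> real" where
  "stick_breaking \<beta> i = \<beta> i * (\<Prod>j<i. 1 - \<beta> j)"

text \<open>The decreasing rearrangement does not depend on the choice of the permutation (see
  \<open>decreasing_rearrangement_unique\<close>), and one exists whenever the terms are positive and
  tend to \<open>0\<close>, as is almost surely the case for the sequences considered below.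
  The zero sequence is a default value for sequences which cannot be rearranged.\<close>

definition decreasing_rearrangement :: "(nat \<Rightarrow> real) \<Rightarrow> nat \<Rightarrow> real" where
  "decreasing_rearrangement x =
     (if \<exists>\<pi>. bij \<pi> \<and> decseq (x \<circ> \<pi>) then x \<circ> (SOME \<pi>. bij \<pi> \<and> decseq (x \<circ> \<pi>)) else (\<lambda>_. 0))"

lemma decseq_bij_le:
  fixes x :: "nat \<Rightarrow> real"
  assumes "bij \<pi>" "decseq (x \<circ> \<pi>)" "bij \<rho>" "decseq (x \<circ> \<rho>)"
  shows "x (\<rho> i) \<le> x (\<pi> i)"
proof (rule ccontr)
  assume *: "\<not> x (\<rho> i) \<le> x (\<pi> i)"
  have "\<rho> ` {..i} \<subseteq> \<pi> ` {..<i}"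
  proof (intro subsetI)
    fix m assume "m \<in> \<rho> ` {..i}"
    then obtain j where j: "j \<le> i" "m = \<rho> j" by auto
    obtain l where l: "m = \<pi> l" using assms(1) by (metis bij_pointE)
    have "x (\<rho> i) \<le> x m" using decseqD[OF assms(4) j(1)] j by simp
    then have "l < i" using decseqD[OF assms(2), of i l] l * by (cases "l < i") auto
    then show "m \<in> \<pi> ` {..<i}" using l by auto
  qed
  then have "card (\<rho> ` {..i}) \<le> card (\<pi> ` {..<i})" by (intro card_mono) auto
  moreover have "inj_on \<rho> {..i}" "inj_on \<pi> {..<i}"
    using assms(1,3) by (meson bij_is_inj inj_on_subset subset_UNIV)+
  ultimately show False by (simp add: card_image)
qed

lemma decreasing_rearrangement_unique:
  assumes "bij \<pi>" "decseq (x \<circ> \<pi>)"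
  shows "decreasing_rearrangement x = x \<circ> \<pi>"
proof -
  define \<rho> where "\<rho> = (SOME \<pi>. bij \<pi> \<and> decseq (x \<circ> \<pi>))"
  have r: "bij \<rho> \<and> decseq (x \<circ> \<rho>)"
    unfolding \<rho>_def by (rule someI[of _ \<pi>]) (use assms in blast)
  have "decreasing_rearrangement x = x \<circ> \<rho>"
    unfolding decreasing_rearrangement_def \<rho>_def using assms by auto
  moreover have "x (\<rho> i) = x (\<pi> i)" for i
    using decseq_bij_le[of \<pi> x \<rho> i] decseq_bij_le[of \<rho> x \<pi> i] assms r by simp
  ultimately show ?thesis by (auto simp: fun_eq_iff)
qed

text \<open>With the usual 1-based indexing, \<open>\<beta>\<^sub>i\<close> has distribution \<open>Beta(1 - \<alpha>, \<theta> + i * \<alpha>)\<close>;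
  here this is the coordinate of index \<open>i - 1\<close>.\<close>

definition poisson_dirichlet :: "real \<Rightarrow> real \<Rightarrow> (nat \<Rightarrow> real) measure" where
  "poisson_dirichlet \<alpha> \<theta> =
     distr (\<Pi>\<^sub>M i\<in>UNIV. beta_distribution (1 - \<alpha>) (\<theta> + real (Suc i) * \<alpha>)) (\<Pi>\<^sub>M i\<in>UNIV. borel)
       (\<lambda>\<beta>. decreasing_rearrangement (stick_breaking \<beta>))"

lemma poisson_dirichlet_inverse:
  assumes "k > 0"
  shows "poisson_dirichlet (1 / real k) (1 / real k) =
    distr (\<Pi>\<^sub>M i\<in>UNIV. beta_distribution ((real k - 1) / real k) ((real (Suc i) + 1) / real k))
      (\<Pi>\<^sub>M i\<in>UNIV. borel) (\<lambda>\<beta>. decreasing_rearrangement (stick_breaking \<beta>))"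
proof -
  have 1: "1 - 1 / real k = (real k - 1) / real k" using assms by (simp add: field_simps)
  have 2: "1 / real k + real (Suc i) * (1 / real k) = (real (Suc i) + 1) / real k" for i
    by (simp add: add_divide_distrib)
  show ?thesis unfolding poisson_dirichlet_def 1 2 ..
qed

end

theory Submission imports Defs begin

text \<open>Label the blocks in order of creation. A block made of \<open>c\<close> strings offers \<open>k * c - 1\<close> gaps
  and \<open>b\<close> blocks leave \<open>b + 1\<close> gaps between and around them, so the labels of the successive
  insertions follow the Chinese restaurant process with parameters \<open>1/k\<close>, \<open>1/k\<close>. The same law is
  obtained by first breaking a stick with the independent Beta variables of the
  Poisson-Dirichlet distribution and then sampling from the pieces, with all pieces that
  have not yet been used (in order) replaced by the first unused one: averaging the product of
  sampling probabilities gives a product of Beta moments, which telescopes to the product of the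
  transition probabilities. For the sampling process the label frequencies converge almost surely
  to the stick lengths, by Hoeffding's inequality and the Borel-Cantelli lemma. Almost sure
  convergence depends only on the law of the label sequence, hence it carries over.
  The stick lengths sum to \<open>1\<close>, so the convergence holds in \<open>\<ell>\<^sup>1\<close>, and passing to the decreasing
  rearrangement is a contraction for the supremum norm.\<close>

section \<open>Decreasing rearrangements\<close>

text \<open>Of the \<open>k * (n + 1) + 1\<close> gaps after \<open>n + 1\<close> strings,
  \<open>k * c - 1\<close> lie in a block of \<open>c\<close> strings. Dividing by \<open>k\<close>
  gives the probability (c - 1/k) / (n + 1 + 1/k) for this block and (1/k + b/k) / (n + 1 + 1/k) for
  a new one, which is where both parameters 1/k come from.

  The obstacle is that the limit must be a random variable on the given space \<open>M\<close>,
  which carries no sticks. Hence the limit is a measurable functional of the label sequence alone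
  (\<open>limit_freq\<close>, then ranked), and good behaviour is membership in a measurable set
  \<open>regular\<close> of label sequences. Both depend only on the law of the labels, so no
  coupling with the sampling process is required.

  Equality of the two laws is checked on finite prefixes without conditional probabilities. On one
  side the gap sequences that produce a given prefix of labels are counted; on the other a monomial
  in the stick variables and their complements is integrated.\<close>

definition rearrangeable :: "(nat \<Rightarrow> real) \<Rightarrow> bool" where
  "rearrangeable x \<longleftrightarrow> (\<forall>j. finite {l. x j < x l})"

text \<open>Sorting by value, with ties broken by index, is a strict total order in which every
  index has finitely many predecessors. The number of predecessors is an injective rank whose range
  is an infinite initial segment, so it is a bijection; its inverse sorts the sequence.\<close>

lemma rearrangeable_imp_bij:
  assumes "rearrangeable x"
  obtains \<pi> where "bij \<pi>" "decseq (x \<circ> \<pi>)"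
proof -
  define before where "before l j \<longleftrightarrow> x j < x l \<or> (x l = x j \<and> l < j)" for l j
  define \<rho> where "\<rho> j = card {l. before l j}" for j
  have fin: "finite {l. before l j}" for j
  proof (rule finite_subset)
    show "{l. before l j} \<subseteq> {l. x j < x l} \<union> {..<j}" by (auto simp: before_def)
    show "finite ({l. x j < x l} \<union> {..<j})" using assms by (auto simp: rearrangeable_def)
  qed
  have mono: "\<rho> l < \<rho> j" if "before l j" for l j
  proof -
    have "{i. before i l} \<subset> {i. before i j}"
      using that by (auto simp: before_def)
    then show ?thesis unfolding \<rho>_def by (intro psubset_card_mono fin)
  qed
  have total: "before l j \<or> before j l" if "l \<noteq> j" for l j
    using that by (auto simp: before_def)
  have inj: "inj \<rho>"
  proof (rule injI)
    fix l j assume "\<rho> l = \<rho> j"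
    then show "l = j" using mono[of l j] mono[of j l] total[of l j] by fastforce
  qed
  have down: "s \<in> range \<rho>" if "s < \<rho> j" for s j
  proof -
    have "\<rho> ` {l. before l j} = {..<\<rho> j}"
    proof (rule card_subset_eq)
      show "\<rho> ` {l. before l j} \<subseteq> {..<\<rho> j}" using mono by auto
      have "card (\<rho> ` {l. before l j}) = card {l. before l j}"
        by (rule card_image[OF inj_on_subset[OF inj subset_UNIV]])
      then show "card (\<rho> ` {l. before l j}) = card {..<\<rho> j}" by (simp add: \<rho>_def)
    qed simp
    then show ?thesis using that by blast
  qed
  have "s \<in> range \<rho>" for s
  proof -
    have "infinite (range \<rho>)" using inj by (simp add: finite_image_iff)
    then obtain m where "m > s" "m \<in> range \<rho>" unfolding infinite_nat_iff_unbounded by blast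
    then show ?thesis using down by blast
  qed
  then have "range \<rho> = UNIV" by blast
  with inj have bij: "bij \<rho>" by (simp add: bij_def)
  have "decseq (x \<circ> inv \<rho>)"
  proof (rule decseq_SucI)
    fix i
    have "\<not> before (inv \<rho> (Suc i)) (inv \<rho> i)"
      using mono[of "inv \<rho> (Suc i)" "inv \<rho> i"] bij by (auto simp: bij_is_surj surj_f_inv_f)
    then show "(x \<circ> inv \<rho>) (Suc i) \<le> (x \<circ> inv \<rho>) i" by (auto simp: before_def)
  qed
  then show ?thesis using that bij bij_imp_bij_inv by blast
qed

text \<open>Removes the quantifier over permutations from the definition of the rearrangement, which
  makes its domain accessible to measurability arguments.\<close>

lemma rearrangeable_iff:
  "rearrangeable x \<longleftrightarrow> (\<exists>\<pi>. bij \<pi> \<and> decseq (x \<circ> \<pi>))"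
proof
  assume "\<exists>\<pi>. bij \<pi> \<and> decseq (x \<circ> \<pi>)"
  then obtain \<pi> where p: "bij \<pi>" "decseq (x \<circ> \<pi>)" by blast
  show "rearrangeable x" unfolding rearrangeable_def
  proof
    fix j
    obtain m where m: "j = \<pi> m" using p by (metis bij_pointE)
    have "l \<in> \<pi> ` {..<m}" if "x j < x l" for l
    proof -
      obtain i where i: "l = \<pi> i" using p by (metis bij_pointE)
      have "i < m" using decseqD[OF p(2), of m i] that m i by force
      then show ?thesis using i by auto
    qed
    then have "{l. x j < x l} \<subseteq> \<pi> ` {..<m}" by auto
    then show "finite {l. x j < x l}" by (rule finite_subset) simp
  qed
qed (use rearrangeable_imp_bij in blast)

text \<open>A description of the ranked values that mentions no permutation; both the Lipschitz
  estimate and measurability rest on it.\<close>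

lemma decreasing_rearrangement_ge_iff:
  assumes "rearrangeable x"
  shows "t \<le> decreasing_rearrangement x i \<longleftrightarrow>
    (\<exists>F. finite F \<and> card F = Suc i \<and> (\<forall>l\<in>F. t \<le> x l))"
proof -
  obtain \<pi> where p: "bij \<pi>" "decseq (x \<circ> \<pi>)" using rearrangeable_imp_bij[OF assms] .
  have eq: "decreasing_rearrangement x i = x (\<pi> i)"
    using decreasing_rearrangement_unique[OF p] by simp
  show ?thesis
  proof
    assume t: "t \<le> decreasing_rearrangement x i"
    have "card (\<pi> ` {..i}) = Suc i"
      using p by (subst card_image) (auto intro: inj_on_subset simp: bij_def)
    moreover have "t \<le> x (\<pi> j)" if "j \<le> i" for j
      using decseqD[OF p(2) that] t eq by simp
    ultimately show "\<exists>F. finite F \<and> card F = Suc i \<and> (\<forall>l\<in>F. t \<le> x l)"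
      by (intro exI[of _ "\<pi> ` {..i}"]) auto
  next
    assume "\<exists>F. finite F \<and> card F = Suc i \<and> (\<forall>l\<in>F. t \<le> x l)"
    then obtain F where F: "finite F" "card F = Suc i" "\<forall>l\<in>F. t \<le> x l" by blast
    have "\<not> F \<subseteq> \<pi> ` {..<i}"
    proof
      assume "F \<subseteq> \<pi> ` {..<i}"
      then have "card F \<le> card (\<pi> ` {..<i})" by (intro card_mono) auto
      also have "\<dots> \<le> i" using card_image_le[of "{..<i}" \<pi>] by simp
      finally show False using F by simp
    qed
    then obtain l where l: "l \<in> F" "l \<notin> \<pi> ` {..<i}" by blast
    obtain m where m: "l = \<pi> m" using p by (metis bij_pointE)
    have "i \<le> m" using l m by (meson imageI lessThan_iff not_less)
    then have "x (\<pi> m) \<le> x (\<pi> i)" using decseqD[OF p(2)] by simp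
    then show "t \<le> decreasing_rearrangement x i" using F(3) l(1) m eq by force
  qed
qed

text \<open>A set of \<open>i + 1\<close> indices on which \<open>x\<close> is at least
  \<open>t\<close> is one on which \<open>y\<close> is at least \<open>t - e\<close>; then exchange
  \<open>x\<close> and \<open>y\<close>.\<close>

lemma decreasing_rearrangement_lipschitz:
  assumes "rearrangeable x" "rearrangeable y" and le: "\<And>l. \<bar>x l - y l\<bar> \<le> e"
  shows "\<bar>decreasing_rearrangement x i - decreasing_rearrangement y i\<bar> \<le> e"
proof -
  have "decreasing_rearrangement x i - e \<le> decreasing_rearrangement y i"
    if xy: "rearrangeable x" "rearrangeable y" "\<And>l. \<bar>x l - y l\<bar> \<le> e" for x y
  proof -
    obtain F where F: "finite F" "card F = Suc i" "\<forall>l\<in>F. decreasing_rearrangement x i \<le> x l"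
      using decreasing_rearrangement_ge_iff[OF xy(1), of "decreasing_rearrangement x i" i] by auto
    have "decreasing_rearrangement x i - e \<le> y l" if "l \<in> F" for l
      using xy(3)[of l] F(3) that by force
    then show ?thesis
      using decreasing_rearrangement_ge_iff[OF xy(2)] F by blast
  qed
  from this[OF assms] this[OF assms(2,1)] le show ?thesis
    by (fastforce simp: abs_minus_commute abs_le_iff)
qed

lemma decreasing_rearrangement_nonneg:
  assumes "\<And>l. x l \<ge> 0"
  shows "decreasing_rearrangement x i \<ge> 0"
proof (cases "\<exists>\<pi>. bij \<pi> \<and> decseq (x \<circ> \<pi>)")
  case True
  then obtain \<pi> where "bij \<pi>" "decseq (x \<circ> \<pi>)" by blast
  then show ?thesis using assms by (simp add: decreasing_rearrangement_unique)
qed (simp only: decreasing_rearrangement_def if_False order_refl)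

text \<open>Nonnegative series converge unconditionally, so reindexing by a bijection preserves the
  sum.\<close>

lemma decreasing_rearrangement_sums:
  assumes "rearrangeable x" "\<And>l. x l \<ge> 0" "x sums s"
  shows "decreasing_rearrangement x sums s"
proof -
  obtain \<pi> where p: "bij \<pi>" "decseq (x \<circ> \<pi>)" using rearrangeable_imp_bij[OF assms(1)] .
  have "(x has_sum s) UNIV" using assms by (intro sums_nonneg_imp_has_sum) auto
  then have "((\<lambda>i. x (\<pi> i)) has_sum s) UNIV"
    using has_sum_reindex_bij_betw[of \<pi> UNIV UNIV x s] p by simp
  then have "(\<lambda>i. x (\<pi> i)) sums s" by (rule has_sum_imp_sums)
  then show ?thesis by (simp add: decreasing_rearrangement_unique[OF p] comp_def)
qed

lemma rearrangeable_finite_support: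
  assumes "\<And>l. x l \<ge> 0" "finite {l. x l \<noteq> 0}"
  shows "rearrangeable x"
  unfolding rearrangeable_def
proof
  fix j
  have "{l. x j < x l} \<subseteq> {l. x l \<noteq> 0}" using assms(1)[of j] by auto
  then show "finite {l. x j < x l}" using assms(2) finite_subset by blast
qed

text \<open>Strict positivity matters: a zero term could have infinitely many larger terms before it
  and would then receive no rank.\<close>

lemma rearrangeable_pos_null:
  assumes "\<And>l. x l > 0" "x \<longlonglongrightarrow> 0"
  shows "rearrangeable x"
  unfolding rearrangeable_def
proof
  fix j
  have "eventually (\<lambda>l. x l < x j) sequentially"
    using order_tendstoD(2)[OF assms(2,1)] .
  then obtain N where "\<And>l. l \<ge> N \<Longrightarrow> x l < x j" by (auto simp: eventually_sequentially)
  then have "{l. x j < x l} \<subseteq> {..<N}" by (force simp: not_le[symmetric])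
  then show "finite {l. x j < x l}" by (rule finite_subset) simp
qed

text \<open>Connects the sorted list of block sizes with the rearrangement of sequences: a sorting
  permutation of the positions of the list, extended by the identity, leaves the padding zeros at
  the end.\<close>

lemma decreasing_rearrangement_list:
  fixes ys :: "nat list"
  shows "decreasing_rearrangement (\<lambda>j. if j < length ys then real (ys ! j) else 0) i =
    (if i < length ys then real (rev (sort ys) ! i) else 0)"
proof -
  let ?x = "\<lambda>j. if j < length ys then real (ys ! j) else 0"
  let ?zs = "rev (sort ys)"
  obtain p where p: "p permutes {..<length ys}" "permute_list p ys = ?zs"
    using mset_eq_permutation[of ?zs ys] by auto
  have x: "?x (p i) = (if i < length ys then real (?zs ! i) else 0)" for i
    using permute_list_nth[OF p(1), of i] permutes_in_image[OF p(1), of i] p(2) by auto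
  have "decseq (?x \<circ> p)"
  proof (rule decseq_SucI)
    fix i
    have "?zs ! Suc i \<le> ?zs ! i" if "Suc i < length ys"
      using that by (simp add: rev_nth sorted_nth_mono)
    then show "(?x \<circ> p) (Suc i) \<le> (?x \<circ> p) i" unfolding comp_def x by auto
  qed
  with p(1) have "decreasing_rearrangement ?x = ?x \<circ> p"
    by (intro decreasing_rearrangement_unique) (auto intro: permutes_bij)
  then show ?thesis using x by simp
qed

text \<open>As \<open>\<bar>f - p\<bar> = f - p + 2 * max 0 (p - f)\<close>, it suffices to
  apply dominated convergence to \<open>max 0 (p - f)\<close>, which is at most \<open>p\<close>.\<close>

lemma l1_convergence:
  fixes f :: "nat \<Rightarrow> nat \<Rightarrow> real" and p :: "nat \<Rightarrow> real"
  assumes f: "\<And>n j. f n j \<ge> 0" "\<And>n. f n sums s" and p: "\<And>j. p j \<ge> 0" "p sums s"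
    and lim: "\<And>j. (\<lambda>n. f n j) \<longlonglongrightarrow> p j"
  shows "(\<lambda>n. \<Sum>j. \<bar>f n j - p j\<bar>) \<longlonglongrightarrow> 0"
    and "summable (\<lambda>j. \<bar>f n j - p j\<bar>)"
proof -
  define a where "a j n = max 0 (p j - f n j)" for j n
  have a: "0 \<le> a j n" "a j n \<le> p j" for j n using f p by (auto simp: a_def)
  have 1: "(\<lambda>n. suminf (\<lambda>j. a j n)) \<longlonglongrightarrow> suminf (\<lambda>_::nat. 0::real)"
  proof (intro conjunct2[OF conjunct2[OF tannerys_theorem[where M = p]]])
    show "((\<lambda>n. a k n) \<longlongrightarrow> 0) sequentially" for k
      unfolding a_def using tendsto_max[OF tendsto_const tendsto_diff[OF tendsto_const lim[of k]], of 0 "p k"]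
      by simp
    show "\<forall>\<^sub>F (k, n) in sequentially \<times>\<^sub>F sequentially. norm (a k n) \<le> p k"
      using a by (intro always_eventually) auto
    show "summable p" using p by (simp add: sums_iff)
  qed simp
  have sa: "summable (\<lambda>j. a j n)" for n
    using a p by (intro summable_comparison_test[of "\<lambda>j. a j n" p]) (auto simp: sums_iff)
  have "(\<lambda>j. f n j - p j + 2 * a j n) sums (s - s + 2 * suminf (\<lambda>j. a j n))" for n
    by (intro sums_add sums_diff sums_mult f p summable_sums sa)
  moreover have "f n j - p j + 2 * a j n = \<bar>f n j - p j\<bar>" for n j by (simp add: a_def max_def)
  ultimately have 2: "(\<lambda>j. \<bar>f n j - p j\<bar>) sums (2 * suminf (\<lambda>j. a j n))" for n by simp
  have "(\<lambda>n. 2 * suminf (\<lambda>j. a j n)) \<longlonglongrightarrow> 0" using tendsto_mult_left[OF 1, of 2] by simp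
  then show "(\<lambda>n. \<Sum>j. \<bar>f n j - p j\<bar>) \<longlonglongrightarrow> 0" using 2 by (simp add: sums_iff)
  show "summable (\<lambda>j. \<bar>f n j - p j\<bar>)" using 2 by (simp add: sums_iff)
qed

text \<open>The supremum distance is at most the l1 distance, which tends to 0, and ranking does not
  increase the supremum distance.\<close>

lemma decreasing_rearrangement_convergence:
  fixes f :: "nat \<Rightarrow> nat \<Rightarrow> real" and p :: "nat \<Rightarrow> real"
  assumes f: "\<And>n j. f n j \<ge> 0" "\<And>n. f n sums s" "\<And>n. rearrangeable (f n)"
    and p: "\<And>j. p j \<ge> 0" "p sums s" "rearrangeable p"
    and lim: "\<And>j. (\<lambda>n. f n j) \<longlonglongrightarrow> p j"
  shows "(\<lambda>n. decreasing_rearrangement (f n) i) \<longlonglongrightarrow> decreasing_rearrangement p i"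
    and "(\<lambda>n. \<Sum>i. \<bar>decreasing_rearrangement (f n) i - decreasing_rearrangement p i\<bar>) \<longlonglongrightarrow> 0"
proof -
  note l1 = l1_convergence[OF f(1,2) p(1,2) lim]
  have bound: "\<bar>f n l - p l\<bar> \<le> (\<Sum>j. \<bar>f n j - p j\<bar>)" for n l
    using sum_le_suminf[OF l1(2), of "{l}"] by simp
  have *: "(\<lambda>n. decreasing_rearrangement (f n) i) \<longlonglongrightarrow> decreasing_rearrangement p i" for i
  proof (rule Lim_null_comparison[THEN LIM_zero_cancel])
    show "\<forall>\<^sub>F n in sequentially. norm (decreasing_rearrangement (f n) i - decreasing_rearrangement p i)
      \<le> (\<Sum>j. \<bar>f n j - p j\<bar>)"
      using decreasing_rearrangement_lipschitz[OF f(3) p(3) bound] by simp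
  qed (rule l1(1))
  show "(\<lambda>n. decreasing_rearrangement (f n) i) \<longlonglongrightarrow> decreasing_rearrangement p i" by (rule *)
  show "(\<lambda>n. \<Sum>i. \<bar>decreasing_rearrangement (f n) i - decreasing_rearrangement p i\<bar>) \<longlonglongrightarrow> 0"
    \<comment> \<open>The ranked sequences are again nonnegative with common sum \<open>s\<close>,
      so their componentwise convergence improves to l1.\<close>
    by (rule l1_convergence[OF decreasing_rearrangement_nonneg decreasing_rearrangement_sums
          decreasing_rearrangement_nonneg decreasing_rearrangement_sums *]) (use f p in auto)
qed

section \<open>Measurability of the decreasing rearrangement\<close>

lemma borel_measurable_rearrangeable [measurable]:
  "Measurable.pred (\<Pi>\<^sub>M i\<in>UNIV. borel) rearrangeable"
proof -
  \<comment> \<open>Finiteness of a set of naturals is boundedness, which leaves only countable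
    quantifiers.\<close>
  have "rearrangeable x \<longleftrightarrow> (\<forall>j. \<exists>N. \<forall>l. N \<le> l \<longrightarrow> x l \<le> x j)" for x
    unfolding rearrangeable_def
  proof (intro all_cong1)
    fix j
    have "finite {l. x j < x l} \<longleftrightarrow> (\<exists>N. \<forall>l\<in>{l. x j < x l}. l < N)"
      by (rule finite_nat_set_iff_bounded)
    then show "finite {l. x j < x l} \<longleftrightarrow> (\<exists>N. \<forall>l. N \<le> l \<longrightarrow> x l \<le> x j)"
      by (metis mem_Collect_eq not_le)
  qed
  then have eq: "rearrangeable = (\<lambda>x. \<forall>j. \<exists>N. \<forall>l. N \<le> l \<longrightarrow> x l \<le> x j)" by (rule ext)
  let ?M = "\<Pi>\<^sub>M i\<in>(UNIV :: nat set). (borel :: real measure)"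
  have [measurable]: "Measurable.pred ?M (\<lambda>x. x l \<le> x j)" for l j
    using borel_measurable_le[OF measurable_component_singleton[of l UNIV "\<lambda>_. borel"]
        measurable_component_singleton[of j UNIV "\<lambda>_. borel"]]
    by (simp add: pred_def)
  show ?thesis
    unfolding eq by (intro pred_intros_countable pred_intros_logic) measurable
qed

lemma measurable_decreasing_rearrangement [measurable]:
  "decreasing_rearrangement \<in> (\<Pi>\<^sub>M i\<in>UNIV. borel) \<rightarrow>\<^sub>M (\<Pi>\<^sub>M i\<in>UNIV. borel)"
proof (rule measurable_PiM_single')
  fix i
  let ?M = "\<Pi>\<^sub>M i\<in>(UNIV :: nat set). (borel :: real measure)"
  \<comment> \<open>Finite index sets are encoded as distinct lists, which range over a countable
    type.\<close>
  define Q where "Q t x \<longleftrightarrow> (\<exists>ls. (length ls = Suc i \<and> distinct ls) \<and> (\<forall>l\<in>set ls. t \<le> x l))"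
    for t and x :: "nat \<Rightarrow> real"
  have Q: "(\<exists>F. finite F \<and> card F = Suc i \<and> (\<forall>l\<in>F. t \<le> x l)) \<longleftrightarrow> Q t x" for t x
    unfolding Q_def by (metis distinct_card finite_distinct_list finite_set)
  have [measurable]: "Measurable.pred ?M (Q t)" for t
    unfolding Q_def by measurable
  show "(\<lambda>x. decreasing_rearrangement x i) \<in> borel_measurable ?M"
    unfolding borel_measurable_iff_ge
  proof
    fix t
    \<comment> \<open>For a sequence that cannot be rearranged the value is the default 0, whence
      \<open>t \<le> 0\<close>.\<close>
    have "(t \<le> decreasing_rearrangement x i) \<longleftrightarrow> (if rearrangeable x then Q t x else t \<le> 0)" for x
    proof (cases "rearrangeable x")
      case True
      then show ?thesis using decreasing_rearrangement_ge_iff[OF True, of t i] Q by simp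
    next
      case False
      then show ?thesis
        unfolding decreasing_rearrangement_def rearrangeable_iff by (simp only: if_False)
    qed
    moreover have "{x \<in> space ?M. if rearrangeable x then Q t x else t \<le> 0} \<in> sets ?M"
      by measurable
    ultimately show "{x \<in> space ?M. t \<le> decreasing_rearrangement x i} \<in> sets ?M" by simp
  qed
qed (auto simp: space_PiM)

section \<open>Blocks and their labels\<close>

lemma mem_blocks_iff:
  "(p, q) \<in> blocks w \<longleftrightarrow> (p, q) \<in> equal_end_substrings w \<and>
    (\<forall>p' q'. (p', q') \<in> equal_end_substrings w \<longrightarrow> p' \<le> p \<longrightarrow> q \<le> q' \<longrightarrow> p' = p \<and> q' = q)"
proof (cases "p \<le> q")
  case True
  then have "{p..q} \<subset> {p'..q'} \<longleftrightarrow> p' \<le> p \<and> q \<le> q' \<and> \<not> (p' = p \<and> q' = q)" for p' q'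
    by (auto simp: psubset_eq)
  then show ?thesis by (auto simp: blocks_def)
qed (auto simp: blocks_def equal_end_substrings_def)

lemma finite_blocks: "finite (blocks w)"
  by (rule finite_subset[of _ "{..length w} \<times> {..length w}"])
    (auto simp: blocks_def equal_end_substrings_def)

text \<open>Without common letters, no substring with equal ends can straddle the border.\<close>

lemma equal_end_substrings_append:
  assumes "set B \<inter> set R = {}"
  shows "(p, q) \<in> equal_end_substrings (B @ R) \<longleftrightarrow>
    (p, q) \<in> equal_end_substrings B \<or>
    (length B \<le> p \<and> length B \<le> q \<and> (p - length B, q - length B) \<in> equal_end_substrings R)"
proof -
  have "B ! p \<noteq> R ! (q - length B)" if "p < length B" "length B \<le> q" "q < length B + length R"
  proof -
    have "B ! p \<in> set B" "R ! (q - length B) \<in> set R" using that by auto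
    then show ?thesis using assms by auto
  qed
  then show ?thesis
    by (auto simp: equal_end_substrings_def nth_append)
qed

text \<open>\<open>B\<close> itself has equal ends, so it absorbs every such substring inside it and
  is a block; the remaining blocks are those of \<open>R\<close>, shifted. Iterating this peels a
  word block by block.\<close>

lemma blocks_append:
  assumes "set B \<inter> set R = {}" "B \<noteq> []" "hd B = last B"
  shows "blocks (B @ R) =
    insert (0, length B - 1) ((\<lambda>(p, q). (p + length B, q + length B)) ` blocks R)"
proof -
  note app = equal_end_substrings_append[OF assms(1)]
  have full: "(0, length B - 1) \<in> equal_end_substrings B"
    using assms by (auto simp: equal_end_substrings_def hd_conv_nth last_conv_nth)
  have B: "p \<le> q \<and> q < length B" if "(p, q) \<in> equal_end_substrings B" for p q
    using that by (auto simp: equal_end_substrings_def)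
  have "(p, q) \<in> blocks (B @ R) \<longleftrightarrow> (p, q) = (0, length B - 1) \<or>
      (length B \<le> p \<and> length B \<le> q \<and> (p - length B, q - length B) \<in> blocks R)" for p q
  proof (cases "(p, q) \<in> equal_end_substrings B")
    case True
    have "(p, q) \<in> blocks (B @ R) \<longleftrightarrow> (p, q) = (0, length B - 1)"
    proof
      assume "(p, q) \<in> blocks (B @ R)"
      then show "(p, q) = (0, length B - 1)"
        using full B[OF True] unfolding mem_blocks_iff app by force
    next
      assume "(p, q) = (0, length B - 1)"
      moreover have "p' = 0 \<and> q' = length B - 1"
        if "(p', q') \<in> equal_end_substrings (B @ R)" "p' \<le> 0" "length B - 1 \<le> q'" for p' q'
        using that B[of p' q'] assms(2) unfolding app by auto
      ultimately show "(p, q) \<in> blocks (B @ R)"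
        using full unfolding mem_blocks_iff app by blast
    qed
    then show ?thesis using B[OF True] by auto
  next
    case False
    then have ne: "(p, q) \<noteq> (0, length B - 1)" using full by auto
    have "(p, q) \<in> blocks (B @ R) \<longleftrightarrow>
      (length B \<le> p \<and> length B \<le> q \<and> (p - length B, q - length B) \<in> blocks R)" (is "?l \<longleftrightarrow> ?r")
    proof
      assume l: ?l
      then have p: "length B \<le> p" "length B \<le> q" "(p - length B, q - length B) \<in> equal_end_substrings R"
        using False unfolding mem_blocks_iff app by auto
      have "p' = p - length B \<and> q' = q - length B"
        if "(p', q') \<in> equal_end_substrings R" "p' \<le> p - length B" "q - length B \<le> q'" for p' q'
      proof -
        have "(p' + length B, q' + length B) \<in> equal_end_substrings (B @ R)"
          using that unfolding app by simp
        then have "p' + length B = p \<and> q' + length B = q"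
          using l that p unfolding mem_blocks_iff by (metis add_le_cancel_right le_add_diff_inverse2)
        then show ?thesis by auto
      qed
      then show ?r using p unfolding mem_blocks_iff by blast
    next
      assume r: ?r
      have "p' = p \<and> q' = q"
        if h: "(p', q') \<in> equal_end_substrings (B @ R)" "p' \<le> p" "q \<le> q'" for p' q'
      proof -
        have "length B \<le> p' \<and> length B \<le> q' \<and> (p' - length B, q' - length B) \<in> equal_end_substrings R"
          using h(1) r h(3) B[of p' q'] unfolding app by auto
        moreover from this have "p' - length B = p - length B \<and> q' - length B = q - length B"
          using r h(2,3) unfolding mem_blocks_iff by (meson diff_le_mono)
        ultimately show ?thesis using r by auto
      qed
      then show ?l using r unfolding mem_blocks_iff app by blast
    qed
    then show ?thesis using ne by blast
  qed
  moreover have "(p, q) \<in> (\<lambda>(p, q). (p + length B, q + length B)) ` blocks R \<longleftrightarrow>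
      length B \<le> p \<and> length B \<le> q \<and> (p - length B, q - length B) \<in> blocks R" for p q
  proof
    assume "length B \<le> p \<and> length B \<le> q \<and> (p - length B, q - length B) \<in> blocks R"
    then show "(p, q) \<in> (\<lambda>(p, q). (p + length B, q + length B)) ` blocks R"
      by (intro image_eqI[of _ _ "(p - length B, q - length B)"]) auto
  qed auto
  ultimately have "(p, q) \<in> blocks (B @ R) \<longleftrightarrow> (p, q) \<in> insert (0, length B - 1)
      ((\<lambda>(p, q). (p + length B, q + length B)) ` blocks R)" for p q
    by (simp only: insert_iff)
  then show ?thesis by (simp only: set_eq_iff split_paired_All) blast
qed

lemma block_sizes_append:
  assumes "set B \<inter> set R = {}" "B \<noteq> []" "hd B = last B"
  shows "block_sizes (B @ R) = add_mset (length B) (block_sizes R)"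
proof -
  let ?s = "\<lambda>(p, q). (p + length B, q + length B)"
  have inj: "inj_on ?s (blocks R)" by (auto simp: inj_on_def)
  have "(0, length B - 1) \<notin> ?s ` blocks R" using assms(2) by auto
  then have "mset_set (blocks (B @ R)) = add_mset (0, length B - 1) (image_mset ?s (mset_set (blocks R)))"
    unfolding blocks_append[OF assms] using inj
    by (simp add: finite_blocks image_mset_mset_set)
  then show ?thesis
    using assms(2) by (simp add: block_sizes_def image_mset.compositionality comp_def case_prod_unfold)
qed

text \<open>A labelling of \<open>w\<close> records for each position the label of the block it belongs to;
  the labels are \<open>0, \<dots>, b - 1\<close> if there are \<open>b\<close> blocks. The list \<open>D\<close> consists of the blocks of
  \<open>w\<close> from left to right together with their labels.\<close>

definition label_blocks :: "(nat \<times> 'b list) list \<Rightarrow> nat list" where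
  "label_blocks D = concat (map (\<lambda>(l, B). replicate (length B) l) D)"

definition block_decomposition :: "(nat \<times> 'b list) list \<Rightarrow> bool" where
  "block_decomposition D \<longleftrightarrow>
     (\<forall>(l, B) \<in> set D. B \<noteq> [] \<and> hd B = last B) \<and>
     sorted_wrt (\<lambda>p q. set (snd p) \<inter> set (snd q) = {}) D \<and>
     distinct (map fst D) \<and> fst ` set D = {..<length D}"

definition labelling :: "'b list \<Rightarrow> nat list \<Rightarrow> bool" where
  "labelling w W \<longleftrightarrow>
     (\<exists>D. block_decomposition D \<and> w = concat (map snd D) \<and> W = label_blocks D)"

lemma label_blocks_simps [simp]:
  "label_blocks [] = []"
  "label_blocks ((l, B) # D) = replicate (length B) l @ label_blocks D"
  "label_blocks (D @ D') = label_blocks D @ label_blocks D'"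
  by (auto simp: label_blocks_def)

lemma length_label_blocks: "length (label_blocks D) = length (concat (map snd D))"
  by (induction D) auto

lemma set_label_blocks:
  assumes "\<forall>(l, B) \<in> set D. B \<noteq> []"
  shows "set (label_blocks D) = fst ` set D"
  using assms
proof (induction D)
  case (Cons a D)
  then show ?case by (cases a) simp
qed simp

text \<open>Each label occupies one run, so the runs of the label word are exactly the blocks. This
  lets gaps be counted from the label word alone.\<close>

lemma remdups_adj_label_blocks:
  assumes "\<forall>(l, B) \<in> set D. B \<noteq> []" "distinct (map fst D)"
  shows "remdups_adj (label_blocks D) = map fst D"
  using assms
proof (induction D)
  case (Cons a D)
  obtain l B where a: "a = (l, B)" by fastforce
  have B: "B \<noteq> []" and IH: "remdups_adj (label_blocks D) = map fst D" using Cons a by auto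
  show ?case
  proof (cases D)
    case Nil
    then show ?thesis using B a by (simp add: remdups_adj_replicate)
  next
    case (Cons b D')
    then obtain m C where b: "b = (m, C)" by fastforce
    then have "label_blocks D \<noteq> []" "hd (label_blocks D) = m" "m \<noteq> l"
      using Cons Cons.prems a by auto
    moreover from this have "dropWhile (\<lambda>y. y = l) (label_blocks D) = label_blocks D"
      by (simp add: dropWhile_eq_self_iff)
    ultimately show ?thesis
      using B a IH remdups_adj_append''[of "replicate (length B) l" "label_blocks D"]
      by (simp add: remdups_adj_replicate)
  qed
qed simp

lemma count_list_label_blocks:
  assumes "distinct (map fst D)" "(l, B) \<in> set D"
  shows "count_list (label_blocks D) l = length B"
  using assms
proof (induction D)
  case (Cons a D)
  obtain m C where a: "a = (m, C)" by fastforce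
  have rep: "count_list (replicate n m) l = (if m = l then n else 0)" for n
    by (induction n) auto
  have zero: "count_list (label_blocks D) l = 0" if "l \<notin> fst ` set D"
    using that by (intro count_notin) (force simp: label_blocks_def)
  show ?case
  proof (cases "m = l")
    case True
    then have "l \<notin> fst ` set D" "B = C" using Cons.prems a by (auto simp: image_iff)
    then show ?thesis using zero a True rep by simp
  next
    case False
    then show ?thesis using Cons a rep by auto
  qed
qed simp

lemma block_sizes_concat:
  assumes "\<forall>(l, B) \<in> set D. B \<noteq> [] \<and> hd B = last B"
    "sorted_wrt (\<lambda>p q. set (snd p) \<inter> set (snd q) = {}) D"
  shows "block_sizes (concat (map snd D)) = mset (map (length \<circ> snd) D)"
  using assms
proof (induction D)
  case Nil
  then show ?case by (simp add: block_sizes_def blocks_def equal_end_substrings_def)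
next
  case (Cons a D)
  obtain l B where a: "a = (l, B)" by fastforce
  have "set B \<inter> set (concat (map snd D)) = {}" using Cons.prems(2) a by auto
  then show ?case using Cons a by (simp add: block_sizes_append)
qed

text \<open>The facts about the decomposition that later arguments use. Distinctness of
  \<open>remdups_adj W\<close> says that equal labels are contiguous.\<close>

lemma labellingD:
  assumes "labelling w W"
  shows "length W = length w" "distinct (remdups_adj W)" "set W = {..<card (set W)}"
    "block_sizes w = mset (map (count_list W) [0..<card (set W)])"
proof -
  obtain D where D: "block_decomposition D" "w = concat (map snd D)" "W = label_blocks D"
    using assms by (auto simp: labelling_def)
  have ne: "\<forall>(l, B) \<in> set D. B \<noteq> []" and dist: "distinct (map fst D)"
    and labels: "fst ` set D = {..<length D}"
    using D(1) by (auto simp: block_decomposition_def)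
  show "length W = length w" using D by (simp add: length_label_blocks)
  show "distinct (remdups_adj W)" using remdups_adj_label_blocks[OF ne dist] dist D by simp
  have set_W: "set W = {..<length D}" using set_label_blocks[OF ne] labels D by simp
  then show "set W = {..<card (set W)}" by simp
  have "block_sizes w = mset (map (length \<circ> snd) D)"
    using D block_sizes_concat by (auto simp: block_decomposition_def)
  also have "map (length \<circ> snd) D = map (count_list W) (map fst D)"
    using D(3) count_list_label_blocks[OF dist] by auto
  also have "mset (map (count_list W) (map fst D)) = image_mset (count_list W) (mset (map fst D))"
    by (simp only: mset_map)
  \<comment> \<open>The blocks stand in positional order and the labels in order of creation; as
    multisets the two agree.\<close>
  also have "mset (map fst D) = mset [0..<card (set W)]"
    using dist labels set_W by (subst set_eq_iff_mset_eq_distinct[symmetric]) (auto simp: atLeast0LessThan)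
  finally show "block_sizes w = mset (map (count_list W) [0..<card (set W)])" by simp
qed

definition gap_label :: "nat list \<Rightarrow> nat \<Rightarrow> nat" where
  "gap_label W g =
     (if 0 < g \<and> g < length W \<and> W ! (g - 1) = W ! g then W ! g else card (set W))"

definition grow :: "nat \<Rightarrow> nat list \<Rightarrow> nat \<Rightarrow> nat list" where
  "grow k W g = insert_string g (replicate k (gap_label W g)) W"

lemma gap_cases:
  assumes "g \<le> length (concat (map snd D))" "\<forall>(l, B) \<in> set D. B \<noteq> []"
  obtains (boundary) D1 D2 where "D = D1 @ D2" "g = length (concat (map snd D1))"
  | (inside) D1 l u v D2 where "D = D1 @ (l, u @ v) # D2" "u \<noteq> []" "v \<noteq> []"
      "g = length (concat (map snd D1)) + length u"
  using assms
proof (induction D arbitrary: g thesis)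
  case Nil
  then show ?case using Nil(1)[of "[]" "[]"] by simp
next
  case (Cons a D)
  obtain l B where a: "a = (l, B)" by fastforce
  consider "g = 0" | "0 < g" "g < length B" | "length B \<le> g" by linarith
  then show ?case
  proof cases
    case 1
    then show ?thesis using Cons.prems(1)[of "[]" "a # D"] by simp
  next
    case 2
    then have "B \<noteq> []" by auto
    with 2 show ?thesis
      using Cons.prems(2)[of "[]" l "take g B" "drop g B" D] a by simp
  next
    case 3
    show ?thesis
    proof (rule Cons.IH[of "g - length B"])
      show "g - length B \<le> length (concat (map snd D))" using Cons.prems(3) a by simp
      show "\<forall>(l, B) \<in> set D. B \<noteq> []" using Cons.prems(4) by simp
    next
      fix D1 D2 assume "D = D1 @ D2" "g - length B = length (concat (map snd D1))"
      then show thesis using Cons.prems(1)[of "a # D1" D2] a 3 by simp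
    next
      fix D1 m u v D2
      assume "D = D1 @ (m, u @ v) # D2" "u \<noteq> []" "v \<noteq> []"
        "g - length B = length (concat (map snd D1)) + length u"
      then show thesis using Cons.prems(2)[of "a # D1" m u v D2] a 3 by simp
    qed
  qed
qed

text \<open>At a border the new string is a block because its letter is new. Inside a block it
  changes neither the first nor the last letter and shares no letter with other blocks, so the block
  merely grows.\<close>

lemma labelling_grow:
  assumes "labelling w W" "N \<notin> set w" "k > 0" "g \<le> length w"
  shows "labelling (insert_string g (replicate k N) w) (grow k W g)"
proof -
  obtain D where D: "block_decomposition D" "w = concat (map snd D)" "W = label_blocks D"
    using assms(1) by (auto simp: labelling_def)
  have ne: "\<forall>(l, B) \<in> set D. B \<noteq> []" and dist: "distinct (map fst D)"
    and labels: "fst ` set D = {..<length D}"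
    using D(1) by (auto simp: block_decomposition_def)
  have card: "card (set W) = length D" using set_label_blocks[OF ne] labels D by simp
  have gD: "g \<le> length (concat (map snd D))" using assms(4) D by simp
  show ?thesis
  proof (cases rule: gap_cases[OF gD ne])
    case (1 D1 D2)
    have len: "length (label_blocks D1) = g" using 1 by (simp add: length_label_blocks)
    have lab: "gap_label W g = length D"
    proof -
      have "False" if g: "0 < g" "g < length W" "W ! (g - 1) = W ! g"
      proof -
        have "W ! (g - 1) = label_blocks D1 ! (g - 1)" "g - 1 < length (label_blocks D1)"
          using D(3) 1 len g by (auto simp: nth_append)
        then have "W ! (g - 1) \<in> set (label_blocks D1)" by simp
        moreover have "W ! g = label_blocks D2 ! 0" "0 < length (label_blocks D2)"
          using D(3) 1 len g by (auto simp: nth_append)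
        then have "W ! g \<in> set (label_blocks D2)" by simp
        moreover have "set (label_blocks D1) \<inter> set (label_blocks D2) = {}"
          using set_label_blocks[of D1] set_label_blocks[of D2] ne dist 1 by auto
        ultimately show False using g by auto
      qed
      then show ?thesis using card by (auto simp: gap_label_def)
    qed
    define D' where "D' = D1 @ (length D, replicate k N) # D2"
    have "block_decomposition D'"
    proof -
      have N: "\<forall>x\<in>set D. set (snd x) \<inter> {N} = {}" using assms(2) D by auto
      have "length D \<notin> fst ` set D" using labels by auto
      have "fst ` set D' = {..<length D'}"
        using labels 1 by (auto simp: D'_def lessThan_Suc)
      moreover have "\<forall>(l, B) \<in> set D'. B \<noteq> [] \<and> hd B = last B"
        using D(1) 1 assms(3) by (auto simp: block_decomposition_def D'_def)
      moreover have "sorted_wrt (\<lambda>p q. set (snd p) \<inter> set (snd q) = {}) D"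
        using D(1) by (simp add: block_decomposition_def)
      then have "sorted_wrt (\<lambda>p q. set (snd p) \<inter> set (snd q) = {}) D'"
        using N assms(3) 1 by (simp add: D'_def sorted_wrt_append ball_Un Int_commute)
      moreover have "distinct (map fst D')"
        using dist \<open>length D \<notin> fst ` set D\<close> 1 by (auto simp: D'_def)
      ultimately show ?thesis by (simp add: block_decomposition_def)
    qed
    moreover have "insert_string g (replicate k N) w = concat (map snd D')"
      using D 1 by (simp add: insert_string_def D'_def)
    moreover have "grow k W g = label_blocks D'"
      using D 1 len lab by (simp add: grow_def insert_string_def D'_def)
    ultimately show ?thesis unfolding labelling_def by blast
  next
    case (2 D1 l u v D2)
    have len: "length (label_blocks D1) = g - length u" "length u \<le> g" "0 < length u" "0 < length v"
      using 2 by (auto simp: length_label_blocks)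
    have W: "W = label_blocks D1 @ replicate (length u) l @ replicate (length v) l @ label_blocks D2"
      using D 2 by (simp add: replicate_add)
    obtain i j where ij: "length u = Suc i" "length v = Suc j"
      using len by (metis gr0_implies_Suc)
    then have "g = Suc (length (label_blocks D1) + i)" using len by simp
    moreover have "(replicate (Suc i) l @ xs) ! i = l" for xs
      by (simp add: nth_append_left del: replicate_Suc)
    ultimately have "0 < g" "g < length W" "W ! g = l" "W ! (g - 1) = l"
      unfolding W ij by (auto simp: nth_append simp del: replicate_Suc)
    then have lab: "gap_label W g = l" by (simp add: gap_label_def)
    define D' where "D' = D1 @ (l, u @ replicate k N @ v) # D2"
    have "block_decomposition D'"
    proof -
      have "N \<notin> set (snd x)" if "x \<in> set D" for x using that assms(2) D by auto
      then have "N \<notin> set (snd x)" if "x \<in> set D1 \<union> set D2" for x using that 2 by auto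
      moreover have "length D' = length D" "fst ` set D' = fst ` set D" using 2 by (auto simp: D'_def)
      moreover have "hd (u @ replicate k N @ v) = hd (u @ v)" "last (u @ replicate k N @ v) = last (u @ v)"
        using 2 by auto
      ultimately show ?thesis
        using D(1) 2 assms(3)
        by (auto simp: block_decomposition_def D'_def sorted_wrt_append)
    qed
    moreover have "insert_string g (replicate k N) w = concat (map snd D')"
      using D 2 by (simp add: insert_string_def D'_def)
    moreover have "grow k W g = label_blocks D'"
    proof -
      have "label_blocks D' = label_blocks D1 @ replicate (length u) l @ replicate k l @
          replicate (length v) l @ label_blocks D2"
        by (simp add: D'_def replicate_add)
      then show ?thesis
        using len by (simp add: grow_def insert_string_def lab) (simp add: W)
    qed
    ultimately show ?thesis unfolding labelling_def by blast
  qed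
qed

lemma labelling_replicate:
  assumes "k > 0"
  shows "labelling (replicate k N) (replicate k 0)"
proof -
  have "block_decomposition [(0, replicate k N)]"
    using assms by (auto simp: block_decomposition_def)
  then show ?thesis
    unfolding labelling_def by (intro exI[of _ "[(0, replicate k N)]"]) simp
qed

section \<open>Counting the gaps that lead to a given label\<close>

lemma card_equal_adjacent:
  "card {g. Suc g < length W \<and> W ! g = j \<and> W ! Suc g = j} + count_list (remdups_adj W) j =
    count_list W j"
proof (induction W rule: remdups_adj.induct)
  case (3 x y W)
  have "{g. Suc g < length (x # y # W) \<and> (x # y # W) ! g = j \<and> (x # y # W) ! Suc g = j} =
      (if x = j \<and> y = j then {0} else {}) \<union>
      Suc ` {g. Suc g < length (y # W) \<and> (y # W) ! g = j \<and> (y # W) ! Suc g = j}" (is "?A = ?B \<union> Suc ` ?C")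
    by (auto simp: image_iff less_Suc_eq_0_disj)
  moreover have "finite ?C" by (rule finite_subset[of _ "{..<length (y # W)}"]) auto
  ultimately have "card ?A = card ?B + card (Suc ` ?C)"
    by (simp only:) (rule card_Un_disjoint; auto)
  then have "card ?A = (if x = j \<and> y = j then 1 else 0) + card ?C"
    by (simp add: card_image)
  then show ?case using 3 by (cases "x = y") auto
qed auto

lemma card_unequal_adjacent:
  assumes "W \<noteq> []"
  shows "card {g. Suc g < length W \<and> W ! g \<noteq> W ! Suc g} + 1 = length (remdups_adj W)"
  using assms
proof (induction W rule: remdups_adj.induct)
  case (3 x y W)
  have "{g. Suc g < length (x # y # W) \<and> (x # y # W) ! g \<noteq> (x # y # W) ! Suc g} =
      (if x = y then {} else {0}) \<union>
      Suc ` {g. Suc g < length (y # W) \<and> (y # W) ! g \<noteq> (y # W) ! Suc g}" (is "?A = ?B \<union> Suc ` ?C")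
    by (auto simp: image_iff less_Suc_eq_0_disj)
  moreover have "finite ?C" by (rule finite_subset[of _ "{..<length (y # W)}"]) auto
  ultimately have "card ?A = card ?B + card (Suc ` ?C)"
    by (simp only:) (rule card_Un_disjoint; auto)
  then have "card ?A = (if x = y then 0 else 1) + card ?C"
    by (simp add: card_image)
  then show ?case using 3 by (cases "x = y") auto
qed auto

text \<open>A single run of \<open>c\<close> letters has \<open>c - 1\<close> inner gaps;
  \<open>b\<close> runs have \<open>b - 1\<close> gaps between them and two at the ends, in total
  \<open>b + 1\<close>.\<close>

lemma card_gap_label:
  assumes "distinct (remdups_adj W)" "set W = {..<b}" "W \<noteq> []"
  shows "card {g. g \<le> length W \<and> gap_label W g = j} =
    (if j < b then count_list W j - 1 else if j = b then b + 1 else 0)"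
proof -
  have "count_list xs j = (if j \<in> set xs then 1 else 0)" if "distinct xs" for xs
    using that by (induction xs) auto
  then have count: "count_list (remdups_adj W) j = (if j < b then 1 else 0)"
    using assms by simp
  have card: "card (set W) = b" "length (remdups_adj W) = b"
    using assms distinct_card[OF assms(1)] by auto
  have W: "W ! g < b" if "g < length W" for g using assms(2) nth_mem[OF that] by auto
  consider "j < b" | "j = b" | "b < j" by linarith
  then show ?thesis
  proof cases
    case 1
    have "{g. g \<le> length W \<and> gap_label W g = j} =
        Suc ` {g. Suc g < length W \<and> W ! g = j \<and> W ! Suc g = j}"
      using 1 card by (auto simp: gap_label_def image_iff gr0_conv_Suc split: if_splits)
    then show ?thesis using card_equal_adjacent[of W j] count 1 by (simp add: card_image)
  next
    case 2
    have "{g. g \<le> length W \<and> gap_label W g = j} =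
        insert 0 (insert (length W) (Suc ` {g. Suc g < length W \<and> W ! g \<noteq> W ! Suc g}))" (is "_ = insert 0 (insert _ (Suc ` ?C))")
    proof (rule set_eqI)
      fix g
      have "g \<le> length W \<and> gap_label W g = j \<longleftrightarrow> g \<le> length W \<and> (g = 0 \<or> g = length W \<or> W ! (g - 1) \<noteq> W ! g)"
        using 2 card W[of g] by (auto simp: gap_label_def)
      then show "g \<in> {g. g \<le> length W \<and> gap_label W g = j} \<longleftrightarrow> g \<in> insert 0 (insert (length W) (Suc ` ?C))"
        by (cases g) (auto simp: image_iff)
    qed
    moreover have "finite ?C" by (rule finite_subset[of _ "{..<length W}"]) auto
    moreover have "0 \<notin> insert (length W) (Suc ` ?C)" "length W \<notin> Suc ` ?C"
      using assms(3) by auto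
    ultimately have "card {g. g \<le> length W \<and> gap_label W g = j} = 2 + card ?C"
      by (simp add: card_image)
    then show ?thesis using card_unequal_adjacent[OF assms(3)] card 2 by simp
  next
    case 3
    then have "{g. g \<le> length W \<and> gap_label W g = j} = {}"
      using card W by (fastforce simp: gap_label_def split: if_splits)
    then show ?thesis using 3 by simp
  qed
qed

section \<open>The law of the label sequence\<close>

text \<open>The process for a deterministic gap sequence. Index \<open>n\<close> stands for order
  \<open>n + 1\<close>, and \<open>g n\<close> is a gap of that word, hence the bound
  \<open>k * Suc n\<close> in what follows.\<close>

primrec stirling_word :: "nat \<Rightarrow> (nat \<Rightarrow> nat) \<Rightarrow> nat \<Rightarrow> nat list" where
  "stirling_word k g 0 = replicate k 1"
| "stirling_word k g (Suc n) = insert_string (g n) (replicate k (Suc (Suc n))) (stirling_word k g n)"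

primrec label_word :: "nat \<Rightarrow> (nat \<Rightarrow> nat) \<Rightarrow> nat \<Rightarrow> nat list" where
  "label_word k g 0 = replicate k 0"
| "label_word k g (Suc n) = grow k (label_word k g n) (g n)"

definition label_seq :: "nat \<Rightarrow> (nat \<Rightarrow> nat) \<Rightarrow> nat \<Rightarrow> nat" where
  "label_seq k g n = gap_label (label_word k g n) (g n)"

text \<open>A label sequence \<open>x\<close> describes the insertions after the initial one, which has created the
  block with label \<open>0\<close>: the \<open>(n + 2)\<close>-nd string is inserted into the block with label \<open>x n\<close>, a new
  block being created if this label has not been used before. The following functions give the
  number of labels used, and the number of strings with a given label, after \<open>n + 1\<close> insertions.\<close>

primrec label_bound :: "(nat \<Rightarrow> nat) \<Rightarrow> nat \<Rightarrow> nat" where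
  "label_bound x 0 = 1"
| "label_bound x (Suc n) = max (label_bound x n) (Suc (x n))"

definition label_count :: "(nat \<Rightarrow> nat) \<Rightarrow> nat \<Rightarrow> nat \<Rightarrow> nat" where
  "label_count x n j = of_bool (j = 0) + card {m. m < n \<and> x m = j}"

definition label_freq :: "(nat \<Rightarrow> nat) \<Rightarrow> nat \<Rightarrow> nat \<Rightarrow> real" where
  "label_freq x n j = real (label_count x n j) / real (Suc n)"

lemma label_bound_pos: "0 < label_bound x n"
  by (induction n) auto

lemma label_bound_cong:
  "(\<And>m. m < n \<Longrightarrow> x m = y m) \<Longrightarrow> label_bound x n = label_bound y n"
  by (induction n) auto

lemma card_less_Suc_conv:
  "card {m. m < Suc n \<and> P m} = card {m. m < n \<and> P m} + of_bool (P n)"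
proof -
  have "{m. m < Suc n \<and> P m} = {m. m < n \<and> P m} \<union> (if P n then {n} else {})"
    by (auto simp: less_Suc_eq)
  then show ?thesis by (auto simp: card_insert_if)
qed

lemma label_count_0 [simp]: "label_count x 0 j = of_bool (j = 0)"
  by (simp add: label_count_def)

lemma label_count_Suc: "label_count x (Suc n) j = label_count x n j + of_bool (x n = j)"
  by (simp add: label_count_def card_less_Suc_conv)

lemma label_count_eq_sum: "real (label_count x n j) = of_bool (j = 0) + (\<Sum>m<n. of_bool (x m = j))"
  by (induction n) (auto simp: label_count_Suc)

lemma label_freq_nonneg: "0 \<le> label_freq x n j"
  by (simp add: label_freq_def)

lemma label_freq_sums: "label_freq x n sums 1"
proof -
  have single: "(\<lambda>j. of_bool (i = j) :: real) sums 1" for i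
    using sums_single[of i "\<lambda>_. 1 :: real"] by (simp add: of_bool_def eq_commute cong: if_cong)
  have "(\<lambda>j. of_bool (0 = j) + (\<Sum>m<n. of_bool (x m = j)) :: real) sums (1 + (\<Sum>m<n. 1))"
    by (intro sums_add sums_sum single)
  then have "(\<lambda>j. real (label_count x n j)) sums real (Suc n)"
    by (simp add: label_count_eq_sum eq_commute cong: if_cong)
  from sums_divide[OF this, of "real (Suc n)"] show ?thesis
    by (simp add: label_freq_def[abs_def])
qed

lemma rearrangeable_label_freq: "rearrangeable (label_freq x n)"
proof (rule rearrangeable_finite_support[OF label_freq_nonneg])
  have "{j. label_freq x n j \<noteq> 0} \<subseteq> insert 0 (x ` {..<n})"
    by (auto simp: label_freq_def label_count_def card_gt_0_iff)
  then show "finite {j. label_freq x n j \<noteq> 0}" by (rule finite_subset) simp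
qed

lemma length_insert_string [simp]:
  "g \<le> length w \<Longrightarrow> length (insert_string g u w) = length u + length w"
  by (simp add: insert_string_def)

lemma count_list_insert_string: "count_list (insert_string g u w) j = count_list u j + count_list w j"
proof -
  have "count_list w j = count_list (take g w) j + count_list (drop g w) j"
    by (metis append_take_drop_id count_list_append)
  then show ?thesis by (simp add: insert_string_def)
qed

lemma set_insert_string: "set (insert_string g u w) = set u \<union> set w"
proof -
  have "set w = set (take g w) \<union> set (drop g w)"
    by (metis append_take_drop_id set_append)
  then show ?thesis by (auto simp: insert_string_def)
qed

lemma count_list_replicate: "count_list (replicate n i) j = (if i = j then n else 0)"
  by (induction n) auto

lemma stirling_word_label_word:
  assumes k: "k > 0" and g: "\<And>m. m < n \<Longrightarrow> g m \<le> k * Suc m"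
  shows "labelling (stirling_word k g n) (label_word k g n)"
    "length (stirling_word k g n) = k * Suc n"
    "set (stirling_word k g n) \<subseteq> {1..Suc n}"
    "set (label_word k g n) = {..<label_bound (label_seq k g) n}"
    "count_list (label_word k g n) j = k * label_count (label_seq k g) n j"
  using g
proof (induction n)
  case 0
  {
    case 1
    show ?case using labelling_replicate[OF k] by simp
  next
    case 2
    show ?case by simp
  next
    case 3
    show ?case by auto
  next
    case 4
    show ?case using k by auto
  next
    case 5
    show ?case by (simp add: count_list_replicate)
  }
next
  case (Suc n)
  let ?W = "label_word k g n"
  have IH: "labelling (stirling_word k g n) ?W" "length (stirling_word k g n) = k * Suc n"
    "set (stirling_word k g n) \<subseteq> {1..Suc n}"
    "set ?W = {..<label_bound (label_seq k g) n}"
    "count_list ?W j = k * label_count (label_seq k g) n j"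
    if "\<And>m. m < Suc n \<Longrightarrow> g m \<le> k * Suc m" using Suc.IH that by auto
  {
    case 1
    then show ?case using IH k by (auto intro!: labelling_grow)
  next
    case 2
    then show ?case using IH by simp
  next
    case 3
    then show ?case using IH by (force simp: set_insert_string)
  next
    case 4
    have "card (set ?W) = label_bound (label_seq k g) n" using IH(4)[OF 4] by simp
    moreover have "label_seq k g n \<in> set ?W \<or> label_seq k g n = card (set ?W)"
      by (auto simp: label_seq_def gap_label_def)
    moreover have "j < label_bound (label_seq k g) n" if "j \<in> set ?W" for j
      using that IH(4)[OF 4] by simp
    ultimately have "label_seq k g n \<le> label_bound (label_seq k g) n"
      by fastforce
    moreover have "set (label_word k g (Suc n)) = insert (label_seq k g n) {..<label_bound (label_seq k g) n}"
      using IH(4)[OF 4] k by (simp add: grow_def set_insert_string label_seq_def)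
    moreover have "{..<max b (Suc l)} = insert l {..<b}" if "l \<le> b" for b l :: nat
      using that by auto
    ultimately show ?case by (simp only: label_bound.simps)
  next
    case 5
    then show ?case using IH
      by (simp add: grow_def count_list_insert_string count_list_replicate label_count_Suc label_seq_def[of k g n])
  }
qed

lemma decreasing_rearrangement_scale:
  assumes "rearrangeable x" "c \<ge> 0"
  shows "decreasing_rearrangement (\<lambda>j. c * x j) i = c * decreasing_rearrangement x i"
proof -
  obtain \<pi> where p: "bij \<pi>" "decseq (x \<circ> \<pi>)" using rearrangeable_imp_bij[OF assms(1)] .
  then have "decseq ((\<lambda>j. c * x j) \<circ> \<pi>)"
    using assms(2) by (auto simp: monotone_on_def intro: mult_left_mono)
  then show ?thesis using p by (simp add: decreasing_rearrangement_unique)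
qed

text \<open>Ranking forgets the labels, and the factor \<open>k\<close> between strings and letters
  cancels against the normalisation.\<close>

lemma ranked_block_size_stirling_word:
  assumes "k > 0" "\<And>m. m < n \<Longrightarrow> g m \<le> k * Suc m"
  shows "real (ranked_block_size (stirling_word k g n) i) / real (k * Suc n) =
    decreasing_rearrangement (label_freq (label_seq k g) n) i"
proof -
  let ?x = "label_seq k g" and ?W = "label_word k g n" and ?w = "stirling_word k g n"
  note P = stirling_word_label_word[of k n g, OF assms]
  let ?b = "label_bound ?x n"
  let ?ys = "map (count_list ?W) [0..<?b]"
  have "block_sizes ?w = mset ?ys" using labellingD(4)[OF P(1)] P(4) by simp
  then have "real (ranked_block_size ?w i) = (if i < length ?ys then real (rev (sort ?ys) ! i) else 0)"
    unfolding ranked_block_size_def Let_def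
    by (simp only: sorted_list_of_multiset_mset length_rev length_sort if_distrib[of real] of_nat_0)
  also have "\<dots> = decreasing_rearrangement (\<lambda>j. if j < length ?ys then real (?ys ! j) else 0) i"
    by (rule decreasing_rearrangement_list[symmetric])
  also have "(\<lambda>j. if j < length ?ys then real (?ys ! j) else 0) = (\<lambda>j. real (k * Suc n) * label_freq ?x n j)"
  proof
    fix j
    have "count_list ?W j = 0" if "\<not> j < ?b" using that P(4) by (intro count_notin) auto
    then show "(if j < length ?ys then real (?ys ! j) else 0) = real (k * Suc n) * label_freq ?x n j"
      using P(5)[of j] assms(1) by (auto simp: label_freq_def field_simps)
  qed
  also have "decreasing_rearrangement \<dots> i =
      real (k * Suc n) * decreasing_rearrangement (label_freq ?x n) i"
    by (intro decreasing_rearrangement_scale rearrangeable_label_freq) simp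
  finally show ?thesis using assms(1) by (simp del: of_nat_Suc of_nat_mult)
qed

text \<open>The number of gaps leading to the label \<open>x n\<close>.\<close>

definition gap_count :: "nat \<Rightarrow> (nat \<Rightarrow> nat) \<Rightarrow> nat \<Rightarrow> nat" where
  "gap_count k x n =
     (if x n < label_bound x n then k * label_count x n (x n) - 1
      else if x n = label_bound x n then label_bound x n + 1 else 0)"

text \<open>Extensional functions represent each finite gap prefix exactly once, so that
  cardinalities count prefixes.\<close>

definition gap_seqs :: "nat \<Rightarrow> (nat \<Rightarrow> nat) \<Rightarrow> nat \<Rightarrow> (nat \<Rightarrow> nat) set" where
  "gap_seqs k x n = {g \<in> {..<n} \<rightarrow>\<^sub>E UNIV. \<forall>m<n. g m \<le> k * Suc m \<and> label_seq k g m = x m}"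

lemma label_word_cong:
  "(\<And>m. m < n \<Longrightarrow> g m = h m) \<Longrightarrow> label_word k g n = label_word k h n"
  by (induction n) auto

lemma label_seq_cong:
  "(\<And>m. m \<le> n \<Longrightarrow> g m = h m) \<Longrightarrow> label_seq k g n = label_seq k h n"
  using label_word_cong[of n g h k] by (simp add: label_seq_def)

lemma label_count_cong:
  "(\<And>m. m < n \<Longrightarrow> x m = y m) \<Longrightarrow> label_count x n j = label_count y n j"
  by (induction n) (auto simp: label_count_Suc)

lemma finite_gap_seqs: "finite (gap_seqs k x n)"
proof (rule finite_subset)
  show "gap_seqs k x n \<subseteq> (\<Pi>\<^sub>E m\<in>{..<n}. {..k * Suc m})"
    by (auto simp: gap_seqs_def PiE_iff extensional_def)
qed (auto intro: finite_PiE)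

text \<open>How many gaps lead to the next label depends on the previous labels only, not on the
  gaps that produced them. The count is therefore a product.\<close>

lemma card_gap_seqs:
  assumes "k > 0"
  shows "card (gap_seqs k x n) = (\<Prod>m<n. gap_count k x m)"
proof (induction n)
  case 0
  have "gap_seqs k x 0 = {\<lambda>_. undefined}" by (auto simp: gap_seqs_def)
  then show ?case by simp
next
  case (Suc n)
  let ?Y = "\<lambda>h. {y. y \<le> k * Suc n \<and> gap_label (label_word k h n) y = x n}"
  have card_Y: "card (?Y h) = gap_count k x n" if h: "h \<in> gap_seqs k x n" for h
  proof -
    have le: "\<And>m. m < n \<Longrightarrow> h m \<le> k * Suc m" and lab: "\<And>m. m < n \<Longrightarrow> label_seq k h m = x m"
      using h by (auto simp: gap_seqs_def)
    note P = stirling_word_label_word[of k n h, OF assms le]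
    have len: "length (label_word k h n) = k * Suc n" using P(2) labellingD(1)[OF P(1)] by simp
    then have "label_word k h n \<noteq> []" using assms by auto
    from card_gap_label[OF labellingD(2)[OF P(1)] P(4) this, of "x n"] len
    show ?thesis
      using P(5)[of "x n"] label_bound_cong[of n "label_seq k h" x] label_count_cong[of n "label_seq k h" x] lab
      by (simp add: gap_count_def)
  qed
  \<comment> \<open>A prefix of length \<open>n + 1\<close> is a prefix \<open>h\<close> together
    with one more gap; extensionality makes \<open>h(n := y)\<close> injective in the pair.\<close>
  have "gap_seqs k x (Suc n) = (\<lambda>(h, y). h(n := y)) ` Sigma (gap_seqs k x n) ?Y" (is "_ = ?f ` _")
  proof (intro equalityI subsetI)
    fix g assume g: "g \<in> gap_seqs k x (Suc n)"
    define h where "h = restrict g {..<n}"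
    have w: "label_word k h n = label_word k g n" by (rule label_word_cong) (simp add: h_def)
    have "label_seq k h m = label_seq k g m" if "m < n" for m
      using that by (intro label_seq_cong) (auto simp: h_def)
    then have "h \<in> gap_seqs k x n" using g by (auto simp: gap_seqs_def h_def)
    moreover have "g n \<in> ?Y h" using g by (auto simp: gap_seqs_def w label_seq_def)
    moreover have "g = h(n := g n)"
    proof
      fix m
      show "g m = (h(n := g n)) m"
        using g by (auto simp: gap_seqs_def h_def PiE_iff extensional_def less_Suc_eq)
    qed
    ultimately show "g \<in> ?f ` Sigma (gap_seqs k x n) ?Y"
      by (intro image_eqI[of _ _ "(h, g n)"]) auto
  next
    fix g assume "g \<in> ?f ` Sigma (gap_seqs k x n) ?Y"
    then obtain h y where g: "g = h(n := y)" and h: "h \<in> gap_seqs k x n" and y: "y \<in> ?Y h" by auto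
    have w: "label_word k g n = label_word k h n" unfolding g by (rule label_word_cong) simp
    have "label_seq k g m = label_seq k h m" if "m < n" for m
      using that by (intro label_seq_cong) (auto simp: g)
    moreover have "label_seq k g n = x n" using y by (simp add: label_seq_def w) (simp add: g)
    ultimately show "g \<in> gap_seqs k x (Suc n)"
      using h y by (auto simp: gap_seqs_def g PiE_iff extensional_def less_Suc_eq)
  qed
  moreover have "inj_on ?f (Sigma (gap_seqs k x n) ?Y)"
  proof (rule inj_onI, clarify)
    fix h y h' y'
    assume h: "h \<in> gap_seqs k x n" "h' \<in> gap_seqs k x n" and eq: "h(n := y) = h'(n := y')"
    have "h m = h' m" for m
    proof (cases "m = n")
      case True
      then show ?thesis using h by (auto simp: gap_seqs_def PiE_iff extensional_def)
    next
      case False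
      then show ?thesis using fun_cong[OF eq, of m] by simp
    qed
    then show "h = h' \<and> y = y'" using fun_cong[OF eq, of n] by auto
  qed
  ultimately have "card (gap_seqs k x (Suc n)) = (\<Sum>h\<in>gap_seqs k x n. card (?Y h))"
    by (simp add: card_image card_SigmaI finite_gap_seqs)
  then show ?case using card_Y Suc by simp
qed

definition label_prob :: "nat \<Rightarrow> (nat \<Rightarrow> nat) \<Rightarrow> nat \<Rightarrow> real" where
  "label_prob k x m = real (gap_count k x m) / real (k * Suc m + 1)"

lemma measurable_label_seq:
  assumes [measurable]: "\<And>m. (\<lambda>\<omega>. g \<omega> m) \<in> M \<rightarrow>\<^sub>M count_space UNIV"
  shows "(\<lambda>\<omega>. label_seq k (g \<omega>) m) \<in> M \<rightarrow>\<^sub>M count_space UNIV"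
proof -
  have [measurable]: "(\<lambda>\<omega>. label_word k (g \<omega>) n) \<in> M \<rightarrow>\<^sub>M count_space UNIV" for n
  proof (induction n)
    case (Suc n)
    note [measurable] = Suc
    show ?case by simp
  qed simp
  show ?thesis unfolding label_seq_def by measurable
qed

text \<open>All admissible gap prefixes of a given length are equally likely, so the probability is
  their number times the common weight.\<close>

lemma (in prob_space) prob_label_seq:
  assumes k: "k > 0"
    and indep: "indep_vars (\<lambda>_. count_space UNIV) G {1..}"
    and unif: "\<And>n. n \<ge> 1 \<Longrightarrow> distr M (count_space UNIV) (G n) = measure_pmf (pmf_of_set {0..k * n})"
  shows "prob {\<omega> \<in> space M. \<forall>m<n. label_seq k (\<lambda>m. G (Suc m) \<omega>) m = x m} = (\<Prod>m<n. label_prob k x m)"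
    and "AE \<omega> in M. \<forall>m. G (Suc m) \<omega> \<le> k * Suc m"
proof -
  have G [measurable]: "G (Suc m) \<in> M \<rightarrow>\<^sub>M count_space UNIV" for m
    using indep by (auto simp: indep_vars_def)
  have AE: "AE \<omega> in M. G (Suc m) \<omega> \<le> k * Suc m" for m
  proof -
    have "AE y in distr M (count_space UNIV) (G (Suc m)). y \<le> k * Suc m"
      unfolding unif[of "Suc m", simplified] by (simp add: AE_measure_pmf_iff)
    then show ?thesis by (subst (asm) AE_distr_iff) auto
  qed
  then show AE_all: "AE \<omega> in M. \<forall>m. G (Suc m) \<omega> \<le> k * Suc m" by (simp add: AE_all_countable)
  define E where "E h = {\<omega> \<in> space M. \<forall>m<n. G (Suc m) \<omega> = h m}" for h
  have E_sets [measurable]: "E h \<in> events" for h unfolding E_def by measurable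
  have single: "prob (G (Suc m) -` {i} \<inter> space M) = 1 / real (k * Suc m + 1)" if "i \<le> k * Suc m" for m i
  proof -
    have "prob (G (Suc m) -` {i} \<inter> space M) = measure (distr M (count_space UNIV) (G (Suc m))) {i}"
      by (simp add: measure_distr)
    also have "\<dots> = pmf (pmf_of_set {0..k * Suc m}) i"
      using unif[of "Suc m"] by (simp add: pmf.rep_eq)
    also have "\<dots> = 1 / real (k * Suc m + 1)" using that by (simp add: pmf_of_set)
    finally show ?thesis .
  qed
  have prob_E: "prob (E h) = (\<Prod>m<n. 1 / real (k * Suc m + 1))" if h: "\<And>m. m < n \<Longrightarrow> h m \<le> k * Suc m" for h
  \<comment> \<open>The product rule for independent events requires a nonempty index set.\<close>
  proof (cases "n = 0")
    case False
    have "E h = (\<Inter>i\<in>Suc ` {..<n}. G i -` {h (i - 1)} \<inter> space M)"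
      using False by (auto simp: E_def)
    also have "prob \<dots> = (\<Prod>i\<in>Suc ` {..<n}. prob (G i -` {h (i - 1)} \<inter> space M))"
      using False by (intro indep_varsD[OF indep]) auto
    also have "\<dots> = (\<Prod>m<n. prob (G (Suc m) -` {h m} \<inter> space M))"
      by (subst prod.reindex) auto
    also have "\<dots> = (\<Prod>m<n. 1 / real (k * Suc m + 1))"
      using h by (intro prod.cong single) auto
    finally show ?thesis .
  qed (simp add: E_def prob_space)
  have [measurable]: "(\<lambda>\<omega>. label_seq k (\<lambda>m. G (Suc m) \<omega>) m) \<in> M \<rightarrow>\<^sub>M count_space UNIV" for m
    by (rule measurable_label_seq) simp
  \<comment> \<open>The two events agree only almost everywhere: the uniform law excludes gaps out
    of range merely up to a null set.\<close>
  have "prob {\<omega> \<in> space M. \<forall>m<n. label_seq k (\<lambda>m. G (Suc m) \<omega>) m = x m} = prob (\<Union>h\<in>gap_seqs k x n. E h)"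
  proof (rule finite_measure_eq_AE)
    show "AE \<omega> in M. (\<omega> \<in> {\<omega> \<in> space M. \<forall>m<n. label_seq k (\<lambda>m. G (Suc m) \<omega>) m = x m}) =
      (\<omega> \<in> (\<Union>h\<in>gap_seqs k x n. E h))"
      using AE_space AE_all
    proof eventually_elim
      case (elim \<omega>)
      let ?g = "\<lambda>m. G (Suc m) \<omega>"
      have "(\<forall>m<n. label_seq k ?g m = x m) \<longleftrightarrow> (\<exists>h\<in>gap_seqs k x n. \<forall>m<n. ?g m = h m)"
      proof
        assume *: "\<forall>m<n. label_seq k ?g m = x m"
        have "label_seq k (restrict ?g {..<n}) m = label_seq k ?g m" if "m < n" for m
          using that by (intro label_seq_cong) auto
        then have "restrict ?g {..<n} \<in> gap_seqs k x n"
          using * elim by (auto simp: gap_seqs_def)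
        then show "\<exists>h\<in>gap_seqs k x n. \<forall>m<n. ?g m = h m" by (rule bexI[rotated]) simp
      next
        assume "\<exists>h\<in>gap_seqs k x n. \<forall>m<n. ?g m = h m"
        then obtain h where h: "h \<in> gap_seqs k x n" "\<forall>m<n. ?g m = h m" by blast
        have "label_seq k ?g m = label_seq k h m" if "m < n" for m
          using that h(2) by (intro label_seq_cong) auto
        then show "\<forall>m<n. label_seq k ?g m = x m" using h by (auto simp: gap_seqs_def)
      qed
      then show ?case using elim by (auto simp: E_def)
    qed
    show "{\<omega> \<in> space M. \<forall>m<n. label_seq k (\<lambda>m. G (Suc m) \<omega>) m = x m} \<in> events"
      by measurable
    show "(\<Union>h\<in>gap_seqs k x n. E h) \<in> events"
      by (intro sets.finite_UN finite_gap_seqs E_sets)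
  qed
  also have "\<dots> = (\<Sum>h\<in>gap_seqs k x n. prob (E h))"
  proof (intro finite_measure_finite_Union finite_gap_seqs)
    show "disjoint_family_on E (gap_seqs k x n)"
      unfolding disjoint_family_on_def
    proof (intro ballI impI)
      fix h h' assume h: "h \<in> gap_seqs k x n" "h' \<in> gap_seqs k x n" "h \<noteq> h'"
      then obtain m where m: "h m \<noteq> h' m" by auto
      then have "m < n" using h by (cases "m < n") (auto simp: gap_seqs_def PiE_iff extensional_def)
      then show "E h \<inter> E h' = {}" using m by (auto simp: E_def)
    qed
  qed auto
  also have "\<dots> = real (card (gap_seqs k x n)) * (\<Prod>m<n. 1 / real (k * Suc m + 1))"
    using prob_E by (auto simp: gap_seqs_def)
  also have "\<dots> = (\<Prod>m<n. label_prob k x m)"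
    unfolding card_gap_seqs[OF k] label_prob_def of_nat_prod prod.distrib[symmetric] by simp
  finally show "prob {\<omega> \<in> space M. \<forall>m<n. label_seq k (\<lambda>m. G (Suc m) \<omega>) m = x m} = (\<Prod>m<n. label_prob k x m)" .
qed

section \<open>Moments of the stick lengths\<close>

lemma Beta_real_pos: "0 < a \<Longrightarrow> 0 < b \<Longrightarrow> 0 < Beta a (b :: real)"
  by (simp add: Beta_def Gamma_real_pos)

lemma borel_measurable_beta_density [measurable]: "beta_density a b \<in> borel_measurable borel"
  unfolding beta_density_def by measurable

lemma sets_beta_distribution [simp, measurable_cong]: "sets (beta_distribution a b) = sets borel"
  by (simp add: beta_distribution_def)

lemma space_beta_distribution [simp]: "space (beta_distribution a b) = UNIV"
  by (simp add: beta_distribution_def)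

lemma beta_density_nonneg: "0 < a \<Longrightarrow> 0 < b \<Longrightarrow> 0 \<le> beta_density a b x"
  by (simp add: beta_density_def Beta_real_pos less_imp_le)

lemma nn_integral_beta_density:
  assumes "0 < a" "0 < b"
  shows "(\<integral>\<^sup>+x. ennreal (beta_density a b x) \<partial>lborel) = 1"
proof -
  have "((\<lambda>t. t powr (a - 1) * (1 - t) powr (b - 1)) has_integral Beta a b) {0<..<1}"
    using has_integral_Beta_real[OF assms] by (simp add: has_integral_Icc_iff_Ioo)
  then have "((\<lambda>t. t powr (a - 1) * (1 - t) powr (b - 1) / Beta a b) has_integral Beta a b / Beta a b) {0<..<1}"
    by (rule has_integral_divide)
  then have "((\<lambda>t. t powr (a - 1) * (1 - t) powr (b - 1) / Beta a b) has_integral 1) {0<..<1}"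
    using Beta_real_pos[OF assms] by simp
  then have "((\<lambda>t. if t \<in> {0<..<1} then t powr (a - 1) * (1 - t) powr (b - 1) / Beta a b else 0)
      has_integral 1) UNIV"
    by (subst has_integral_restrict_UNIV)
  also have "(\<lambda>t. if t \<in> {0<..<1} then t powr (a - 1) * (1 - t) powr (b - 1) / Beta a b else 0) = beta_density a b"
    by (auto simp: beta_density_def)
  finally show ?thesis
    using nn_integral_has_integral_lborel[of "beta_density a b" 1] beta_density_nonneg[OF assms] by simp
qed

lemma prob_space_beta_distribution:
  assumes "0 < a" "0 < b"
  shows "prob_space (beta_distribution a b)"
  by (rule prob_spaceI) (simp add: beta_distribution_def emeasure_density nn_integral_beta_density assms)

lemma AE_beta_distribution: "AE x in beta_distribution a b. 0 < x \<and> x < 1"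
  unfolding beta_distribution_def
  by (subst AE_density) (auto simp: beta_density_def)

text \<open>Multiplying a Beta density by the monomial gives a multiple of the Beta density with
  shifted parameters, which has integral 1.\<close>

lemma nn_integral_beta_distribution:
  assumes "0 < a" "0 < b"
  shows "(\<integral>\<^sup>+x. ennreal (x ^ m * (1 - x) ^ n) \<partial>beta_distribution a b) =
    ennreal (Beta (a + real m) (b + real n) / Beta a b)"
proof -
  define c where "c = Beta (a + real m) (b + real n) / Beta a b"
  have pos: "0 < Beta (a + real m) (b + real n)" "0 < Beta a b"
    using assms by (auto intro!: Beta_real_pos add_pos_nonneg)
  then have c: "0 \<le> c" by (simp add: c_def)
  have "beta_density a b x * (x ^ m * (1 - x) ^ n) = c * beta_density (a + real m) (b + real n) x" for x
  proof (cases "0 < x \<and> x < 1")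
    case True
    have "x powr (a + real m - 1) = x powr (a - 1) * x ^ m"
      using True by (simp add: powr_realpow[symmetric] powr_add[symmetric] algebra_simps)
    moreover have "(1 - x) powr (b + real n - 1) = (1 - x) powr (b - 1) * (1 - x) ^ n"
      using True by (simp add: powr_realpow[symmetric] powr_add[symmetric] algebra_simps)
    ultimately show ?thesis using True pos by (simp add: beta_density_def c_def)
  qed (auto simp: beta_density_def)
  moreover have "ennreal (beta_density a b x) * ennreal (x ^ m * (1 - x) ^ n) =
      ennreal (beta_density a b x * (x ^ m * (1 - x) ^ n))" for x
    using beta_density_nonneg[OF assms, of x] by (simp add: ennreal_mult')
  ultimately have "(\<integral>\<^sup>+x. ennreal (x ^ m * (1 - x) ^ n) \<partial>beta_distribution a b) =
      (\<integral>\<^sup>+x. ennreal (c * beta_density (a + real m) (b + real n) x) \<partial>lborel)"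
    unfolding beta_distribution_def by (subst nn_integral_density) auto
  also have "\<dots> = ennreal c * (\<integral>\<^sup>+x. ennreal (beta_density (a + real m) (b + real n) x) \<partial>lborel)"
    using c by (simp add: ennreal_mult' nn_integral_cmult)
  finally show ?thesis using assms by (simp add: nn_integral_beta_density add_pos_nonneg c_def)
qed

text \<open>The identity map on the product space has the product of the coordinate laws as its
  law.\<close>

lemma indep_vars_PiM_coordinates:
  assumes "\<And>i. prob_space (N i)"
  shows "prob_space.indep_vars (\<Pi>\<^sub>M i\<in>UNIV. N i) N (\<lambda>i \<omega>. \<omega> i) UNIV"
proof -
  interpret product_prob_space N UNIV
    by (rule product_prob_spaceI) (rule assms)
  have "distr (PiM UNIV N) (PiM UNIV N) (\<lambda>x. x) = (\<Pi>\<^sub>M i\<in>UNIV. distr (PiM UNIV N) (N i) (\<lambda>\<omega>. \<omega> i))"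
    using distr_id[of "PiM UNIV N"] by (simp add: PiM_component id_def)
  then show ?thesis
    using indep_vars_iff_distr_eq_PiM'[where I = UNIV and M' = N and X = "\<lambda>i \<omega>. \<omega> i"]
    by (simp add: restrict_def measurable_component_singleton)
qed

abbreviation sticks :: "nat \<Rightarrow> (nat \<Rightarrow> real) measure" where
  "sticks k \<equiv> \<Pi>\<^sub>M i\<in>UNIV. beta_distribution ((real k - 1) / real k) ((real (Suc i) + 1) / real k)"

lemma prob_space_sticks:
  assumes "k \<ge> 2"
  shows "prob_space (sticks k)"
  using assms by (intro prob_space_PiM prob_space_beta_distribution) auto

lemma AE_sticks:
  assumes "k \<ge> 2"
  shows "AE \<beta> in sticks k. \<forall>i. 0 < \<beta> i \<and> \<beta> i < 1"
proof -
  have "AE \<beta> in sticks k. 0 < \<beta> i \<and> \<beta> i < 1" for i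
    using assms by (intro AE_PiM_component[of UNIV _ i] prob_space_beta_distribution AE_beta_distribution) auto
  then show ?thesis by (simp add: AE_all_countable)
qed

lemma sticks_moments:
  assumes "k \<ge> 2"
  shows "(\<integral>\<^sup>+\<beta>. ennreal (\<Prod>j<J. \<beta> j ^ A j * (1 - \<beta> j) ^ B j) \<partial>sticks k) =
    ennreal (\<Prod>j<J. Beta ((real k - 1) / real k + real (A j)) ((real (Suc j) + 1) / real k + real (B j)) /
      Beta ((real k - 1) / real k) ((real (Suc j) + 1) / real k))"
proof -
  interpret prob_space "sticks k" by (rule prob_space_sticks[OF assms])
  let ?a = "(real k - 1) / real k" and ?b = "\<lambda>j. (real (Suc j) + 1) / real k"
  have pos: "0 < ?a" "0 < ?b j" for j using assms by (auto intro!: divide_pos_pos)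
  have meas: "(\<lambda>x :: real. ennreal (x ^ A j * (1 - x) ^ B j)) \<in> borel_measurable (beta_distribution ?a (?b j))" for j
    unfolding measurable_cong_sets[OF sets_beta_distribution refl] by measurable
  have ind: "indep_vars (\<lambda>_. borel) (\<lambda>j \<beta>. ennreal (\<beta> j ^ A j * (1 - \<beta> j) ^ B j)) UNIV"
    by (rule indep_vars_compose2[OF indep_vars_PiM_coordinates[OF prob_space_beta_distribution[OF pos]] meas])
  have "(\<integral>\<^sup>+\<beta>. ennreal (\<Prod>j<J. \<beta> j ^ A j * (1 - \<beta> j) ^ B j) \<partial>sticks k) =
      (\<integral>\<^sup>+\<beta>. (\<Prod>j<J. ennreal (\<beta> j ^ A j * (1 - \<beta> j) ^ B j)) \<partial>sticks k)"
    using AE_sticks[OF assms]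
    by (intro nn_integral_cong_AE) (auto elim!: eventually_mono simp: prod_ennreal less_imp_le)
  also have "\<dots> = (\<Prod>j<J. \<integral>\<^sup>+\<beta>. ennreal (\<beta> j ^ A j * (1 - \<beta> j) ^ B j) \<partial>sticks k)"
    by (intro indep_vars_nn_integral indep_vars_subset[OF ind]) auto
  also have "\<dots> = (\<Prod>j<J. \<integral>\<^sup>+x. ennreal (x ^ A j * (1 - x) ^ B j) \<partial>beta_distribution ?a (?b j))"
  proof (intro prod.cong refl)
    fix j
    have "beta_distribution ?a (?b j) = distr (sticks k) (beta_distribution ?a (?b j)) (\<lambda>\<beta>. \<beta> j)"
      using pos by (intro distr_PiM_component[symmetric] prob_space_beta_distribution) auto
    then show "(\<integral>\<^sup>+\<beta>. ennreal (\<beta> j ^ A j * (1 - \<beta> j) ^ B j) \<partial>sticks k) =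
        (\<integral>\<^sup>+x. ennreal (x ^ A j * (1 - x) ^ B j) \<partial>beta_distribution ?a (?b j))"
      using nn_integral_distr[OF measurable_component_singleton[of j UNIV "\<lambda>j. beta_distribution ?a (?b j)", OF UNIV_I],
          of "\<lambda>x. ennreal (x ^ A j * (1 - x) ^ B j)"] meas[of j]
      by (simp only: measurable_distr_eq1)
  qed
  also have "\<dots> = (\<Prod>j<J. ennreal (Beta (?a + real (A j)) (?b j + real (B j)) / Beta ?a (?b j)))"
    by (intro prod.cong refl nn_integral_beta_distribution pos)
  also have "\<dots> = ennreal (\<Prod>j<J. Beta (?a + real (A j)) (?b j + real (B j)) / Beta ?a (?b j))"
    using pos by (intro prod_ennreal divide_nonneg_nonneg Beta_real_pos[THEN less_imp_le] add_pos_nonneg) auto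
  finally show ?thesis .
qed

section \<open>Sampling probabilities as monomials in the stick variables\<close>

definition remaining :: "(nat \<Rightarrow> real) \<Rightarrow> nat \<Rightarrow> real" where
  "remaining \<beta> j = (\<Prod>i<j. 1 - \<beta> i)"

lemma stick_breaking_eq_diff: "stick_breaking \<beta> j = remaining \<beta> j - remaining \<beta> (Suc j)"
  by (simp add: stick_breaking_def remaining_def algebra_simps)

definition sampling_prob :: "(nat \<Rightarrow> real) \<Rightarrow> (nat \<Rightarrow> nat) \<Rightarrow> nat \<Rightarrow> real" where
  "sampling_prob R x m =
     (if x m < label_bound x m then R (x m) - R (Suc (x m))
      else if x m = label_bound x m then R (x m) else 0)"

text \<open>The exponent of \<open>\<beta> j\<close>. The creation of label \<open>j\<close> is
  excluded, since a new label contributes the remainder without a factor \<open>\<beta> j\<close>;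
  \<open>passes\<close> below is the exponent of \<open>1 - \<beta> j\<close>.\<close>

definition hits :: "(nat \<Rightarrow> nat) \<Rightarrow> nat \<Rightarrow> nat \<Rightarrow> nat" where
  "hits x n j = card {m. m < n \<and> x m = j \<and> j < label_bound x m}"

definition passes :: "(nat \<Rightarrow> nat) \<Rightarrow> nat \<Rightarrow> nat \<Rightarrow> nat" where
  "passes x n j = card {m. m < n \<and> j < x m}"

lemma hits_Suc: "hits x (Suc n) j = hits x n j + of_bool (x n = j \<and> j < label_bound x n)"
  unfolding hits_def by (rule card_less_Suc_conv)

lemma passes_Suc: "passes x (Suc n) j = passes x n j + of_bool (j < x n)"
  unfolding passes_def by (rule card_less_Suc_conv)

lemma label_count_eq_hits:
  assumes "\<And>m. m < n \<Longrightarrow> x m \<le> label_bound x m"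
  shows "label_count x n j = hits x n j + of_bool (j < label_bound x n)"
  using assms
proof (induction n)
  case 0
  then show ?case by (simp add: hits_def)
next
  case (Suc n)
  have IH: "label_count x n j = hits x n j + of_bool (j < label_bound x n)"
    using Suc by simp
  have "x n \<le> label_bound x n" using Suc.prems by simp
  then show ?case using IH by (auto simp: label_count_Suc hits_Suc max_def)
qed

text \<open>Both sides count the strings with label at least \<open>j\<close>. For
  \<open>j = 0\<close> these are all \<open>n + 1\<close> strings, the initial one included; for
  larger \<open>j\<close> the initial string, which has label 0, is not among them.\<close>

lemma label_count_add_passes: "label_count x n j + passes x n j =
    (if j = 0 then Suc n else passes x n (j - 1))"
proof (induction n)
  case 0
  show ?case by (simp add: passes_def)
next
  case (Suc n)
  then show ?case by (auto simp: label_count_Suc passes_Suc split: if_splits)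
qed

lemma passes_label_bound:
  assumes "label_bound x n \<le> Suc j"
  shows "passes x n j = 0"
  using assms
proof (induction n)
  case 0
  show ?case by (simp add: passes_def)
next
  case (Suc n)
  then show ?case by (auto simp: passes_Suc)
qed

lemma label_bound_le:
  assumes "\<And>m. m < n \<Longrightarrow> x m \<le> label_bound x m"
  shows "label_bound x n \<le> Suc n"
  using assms
proof (induction n)
  case (Suc n)
  then have "x n \<le> label_bound x n" "label_bound x n \<le> Suc n" by auto
  then show ?case by simp
qed simp

lemma prod_of_bool_less:
  assumes "i \<le> (J :: nat)"
  shows "(\<Prod>j<J. if j < i then f j else 1) = (\<Prod>j<i. f j :: 'a :: comm_monoid_mult)"
proof -
  have "{..<J} \<inter> {j. j < i} = {..<i}" using assms by (auto intro: less_le_trans)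
  then show ?thesis by (simp add: prod.If_cases)
qed

lemma prod_if_eq:
  "(\<Prod>j<(J::nat). if j = i \<and> P j then f j else 1) = (if i < J \<and> P i then f i else 1 :: 'a :: comm_monoid_mult)"
proof (cases "P i")
  case True
  have "(\<Prod>j<J. if j = i \<and> P j then f j else 1) = (\<Prod>j<J. if j = i then f j else 1)"
    using True by (intro prod.cong) auto
  then show ?thesis using True by (simp add: prod.delta)
next
  case False
  then have "(\<Prod>j<J. if j = i \<and> P j then f j else 1) = (\<Prod>j<J. 1)" by (intro prod.cong) auto
  then show ?thesis using False by simp
qed

text \<open>The bound \<open>n \<le> J\<close> suffices because labels appearing in order have
  nonzero exponents only below \<open>n\<close>.\<close>

lemma prod_sampling_prob:
  assumes "\<And>m. m < n \<Longrightarrow> x m \<le> label_bound x m" "n \<le> J"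
  shows "(\<Prod>m<n. sampling_prob (remaining \<beta>) x m) =
    (\<Prod>j<J. \<beta> j ^ hits x n j * (1 - \<beta> j) ^ passes x n j)"
  using assms
proof (induction n)
  case 0
  show ?case by (simp add: hits_def passes_def)
next
  case (Suc n)
  have le: "x n \<le> label_bound x n" "label_bound x n \<le> J"
    using Suc.prems label_bound_le[of n x] by auto
  let ?hits = "\<lambda>j. if j = x n \<and> j < label_bound x n then \<beta> j else 1"
  let ?passes = "\<lambda>j. if j < x n then 1 - \<beta> j else 1"
  have "(\<Prod>j<J. \<beta> j ^ hits x (Suc n) j * (1 - \<beta> j) ^ passes x (Suc n) j) =
      (\<Prod>j<J. (\<beta> j ^ hits x n j * (1 - \<beta> j) ^ passes x n j) * (?hits j * ?passes j))"
    by (intro prod.cong) (auto simp: hits_Suc passes_Suc)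
  also have "\<dots> = (\<Prod>m<n. sampling_prob (remaining \<beta>) x m) * ((\<Prod>j<J. ?hits j) * (\<Prod>j<J. ?passes j))"
    using Suc by (simp add: prod.distrib)
  also have "(\<Prod>j<J. ?passes j) = remaining \<beta> (x n)"
    unfolding remaining_def using le by (intro prod_of_bool_less) auto
  also have "(\<Prod>j<J. ?hits j) = (if x n < label_bound x n then \<beta> (x n) else 1)"
    unfolding prod_if_eq using le by auto
  also have "(if x n < label_bound x n then \<beta> (x n) else 1) * remaining \<beta> (x n) =
      sampling_prob (remaining \<beta>) x n"
    using le by (auto simp: sampling_prob_def remaining_def algebra_simps)
  finally show ?case by simp
qed

lemma Beta_Suc_right:
  assumes "0 < a" "0 < (b :: real)"
  shows "Beta a (b + 1) = Beta a b * (b / (a + b))"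
proof -
  have "b \<notin> \<int>\<^sub>\<le>\<^sub>0" using assms by (auto elim!: nonpos_Ints_cases)
  from Beta_plus1_right[OF this, of a] show ?thesis using assms by (simp add: field_simps)
qed

lemma Beta_Suc_left:
  assumes "0 < a" "0 < (b :: real)"
  shows "Beta (a + 1) b = Beta a b * (a / (a + b))"
  using Beta_Suc_right[of b a] assms by (simp add: Beta_commute add.commute)

text \<open>Adding one letter to a label sequence changes the moment by a product over the labels,
  which telescopes because the sum of the two updated Beta parameters of label \<open>j + 1\<close> is the
  second parameter of label \<open>j\<close>.\<close>

lemma prod_Beta_label_prob:
  assumes k: "k \<ge> 2" and "\<And>m. m < n \<Longrightarrow> x m \<le> label_bound x m" "n \<le> J"
  shows "(\<Prod>j<J. Beta ((real k - 1) / real k + real (hits x n j)) ((real (Suc j) + 1) / real k + real (passes x n j)) /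
      Beta ((real k - 1) / real k) ((real (Suc j) + 1) / real k)) = (\<Prod>m<n. label_prob k x m)"
  using assms(2,3)
proof (induction n)
  case 0
  have "Beta ((real k - 1) / real k) ((real (Suc j) + 1) / real k) \<noteq> 0" for j
    using k by (intro less_imp_neq[symmetric] Beta_real_pos) auto
  then show ?case by (simp add: hits_def passes_def)
next
  case (Suc n)
  let ?a = "\<lambda>j. (real k - 1) / real k + real (hits x n j)"
  let ?b = "\<lambda>j. (real (Suc j) + 1) / real k + real (passes x n j)"
  let ?c = "\<lambda>j. Beta ((real k - 1) / real k) ((real (Suc j) + 1) / real k)"
  \<comment> \<open>For a used label, \<open>D j\<close> is the sum of its two updated parameters
    (\<open>ab\<close>); it is also the updated second parameter of label \<open>j - 1\<close>
    (\<open>D_Suc\<close>). The explicit form makes sense for a new label too.\<close>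
  define D where "D j = (real j + 1) / real k + real (if j = 0 then Suc n else passes x n (j - 1))" for j
  have valid: "x m \<le> label_bound x m" if "m < n" for m using Suc.prems that by auto
  have le: "x n \<le> label_bound x n" "label_bound x n \<le> J"
    using Suc.prems label_bound_le[of n x] by auto
  have pos: "0 < ?a j" "0 < ?b j" "0 < D j" for j
    using k by (auto simp: D_def intro!: add_pos_nonneg divide_pos_pos)
  have D_Suc: "?b j = D (Suc j)" for j by (simp add: D_def)
  have ab: "?a j + ?b j = D j" if "j < label_bound x n" for j
  proof -
    have "hits x n j + 1 + passes x n j = (if j = 0 then Suc n else passes x n (j - 1))"
      using label_count_add_passes[of x n j] label_count_eq_hits[where n = n and x = x and j = j, OF valid] that
      by simp
    then have "real (hits x n j) + 1 + real (passes x n j) = real (if j = 0 then Suc n else passes x n (j - 1))"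
      unfolding of_nat_1[where 'a = real, symmetric] of_nat_add[symmetric] by (simp only:)
    moreover have "(real k - 1) / real k + (real (Suc j) + 1) / real k = (real j + 1) / real k + 1"
      using k by (simp add: field_simps)
    ultimately show ?thesis unfolding D_def by linarith
  qed
  let ?hits = "\<lambda>j. if j = x n \<and> j < label_bound x n then ?a j / D j else 1"
  let ?passes = "\<lambda>j. if j < x n then D (Suc j) / D j else 1"
  have step: "Beta ((real k - 1) / real k + real (hits x (Suc n) j)) ((real (Suc j) + 1) / real k + real (passes x (Suc n) j)) =
      Beta (?a j) (?b j) * (?hits j * ?passes j)" for j
  proof -
    consider "j < x n" | "j = x n" "j < label_bound x n" | "j = x n" "\<not> j < label_bound x n" | "x n < j"
      by linarith
    then show ?thesis
    proof cases
      case 1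
      have "Beta (?a j) (?b j + 1) = Beta (?a j) (?b j) * (D (Suc j) / D j)"
        using Beta_Suc_right[OF pos(1,2)] ab[of j] 1 le D_Suc by simp
      then show ?thesis using 1 by (simp add: hits_Suc passes_Suc add_ac)
    next
      case 2
      have "Beta (?a j + 1) (?b j) = Beta (?a j) (?b j) * (?a j / D j)"
        using Beta_Suc_left[OF pos(1,2)] ab[of j] 2 by simp
      then show ?thesis using 2 by (simp add: hits_Suc passes_Suc add_ac)
    qed (auto simp: hits_Suc passes_Suc)
  qed
  have "(\<Prod>j<J. Beta ((real k - 1) / real k + real (hits x (Suc n) j)) ((real (Suc j) + 1) / real k + real (passes x (Suc n) j)) / ?c j) =
      (\<Prod>j<J. (Beta (?a j) (?b j) / ?c j) * (?hits j * ?passes j))"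
    unfolding step by (intro prod.cong) (simp_all add: field_simps)
  also have "\<dots> = (\<Prod>j<J. Beta (?a j) (?b j) / ?c j) * ((\<Prod>j<J. ?hits j) * (\<Prod>j<J. ?passes j))"
    by (simp only: prod.distrib)
  also have "(\<Prod>j<J. Beta (?a j) (?b j) / ?c j) = (\<Prod>m<n. label_prob k x m)"
    using Suc by simp
  also have "(\<Prod>j<J. ?passes j) = (\<Prod>j<x n. D (Suc j) / D j)"
    using le by (intro prod_of_bool_less) auto
  also have "\<dots> = D (x n) / D 0"
    using pos(3) by (intro prod_lessThan_telescope) (simp add: less_imp_neq[symmetric])
  also have "(\<Prod>j<J. ?hits j) = (if x n < label_bound x n then ?a (x n) / D (x n) else 1)"
    unfolding prod_if_eq using le by auto
  also have "(if x n < label_bound x n then ?a (x n) / D (x n) else 1) * (D (x n) / D 0) = label_prob k x n"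
  proof -
    \<comment> \<open>The surviving denominator is the total number of gaps, divided by
      \<open>k\<close>.\<close>
    have D0: "D 0 = real (k * Suc n + 1) / real k" using k by (simp add: D_def field_simps)
    show ?thesis
    proof (cases "x n < label_bound x n")
      case True
      have "label_count x n (x n) = hits x n (x n) + 1"
        using label_count_eq_hits[where n = n and x = x and j = "x n", OF valid] True by simp
      then have "?a (x n) = real (gap_count k x n) / real k"
        using k True by (simp add: gap_count_def of_nat_diff field_simps)
      then show ?thesis
        using True k pos(3)[of "x n"] unfolding D0 label_prob_def by simp
    next
      case False
      then have eq: "x n = label_bound x n" using le by simp
      \<comment> \<open>No string lies beyond the last used label, so only
        \<open>(x n + 1) / k\<close> remains: the \<open>b + 1\<close> gaps around and between the
        blocks.\<close>
      have "D (x n) = real (gap_count k x n) / real k"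
        using eq label_bound_pos[of x n] passes_label_bound[of x n "label_bound x n - 1"]
        by (simp add: D_def gap_count_def)
      then show ?thesis using False k unfolding D0 label_prob_def by simp
    qed
  qed
  finally show ?case by simp
qed

text \<open>For labels appearing in order this is the moment identity. A sequence that skips a label
  has a vanishing factor on both sides.\<close>

lemma nn_integral_sampling_prob:
  assumes k: "k \<ge> 2"
  shows "(\<integral>\<^sup>+\<beta>. ennreal (\<Prod>m<n. sampling_prob (remaining \<beta>) x m) \<partial>sticks k) =
    ennreal (\<Prod>m<n. label_prob k x m)"
proof (cases "\<forall>m<n. x m \<le> label_bound x m")
  case True
  then show ?thesis
    using prod_Beta_label_prob[OF k, where n = n and x = x and J = n]
      sticks_moments[OF k, where J = n and A = "hits x n" and B = "passes x n"]
    by (simp add: prod_sampling_prob[where n = n and x = x and J = n])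
next
  case False
  then obtain m where m: "m < n" "label_bound x m < x m" by (auto simp: not_le)
  have 1: "(\<Prod>m<n. sampling_prob (remaining \<beta>) x m) = 0" for \<beta>
    using m by (intro prod_zero) (auto simp: sampling_prob_def intro!: bexI[of _ m])
  have 2: "(\<Prod>m<n. label_prob k x m) = 0"
    using m by (intro prod_zero) (auto simp: label_prob_def gap_count_def intro!: bexI[of _ m])
  show ?thesis unfolding 1 2 by simp
qed

text \<open>The expected remainder tends to 0 and the remainders decrease. This is what makes the
  stick lengths sum to 1.\<close>

lemma AE_remaining_tendsto_0:
  assumes k: "k \<ge> 2"
  shows "AE \<beta> in sticks k. remaining \<beta> \<longlonglongrightarrow> 0"
proof -
  interpret prob_space "sticks k" by (rule prob_space_sticks[OF k])
  have meas [measurable]: "(\<lambda>\<beta>. remaining \<beta> n) \<in> borel_measurable (sticks k)" for n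
    unfolding remaining_def by measurable
  have E: "(\<integral>\<^sup>+\<beta>. ennreal (remaining \<beta> n) \<partial>sticks k) \<le> ennreal (2 / (real n + 2))" for n
  proof -
    let ?a = "(real k - 1) / real k" and ?b = "\<lambda>j. (real (Suc j) + 1) / real k"
    have pos: "0 < ?a" "0 < ?b j" for j using k by (auto intro!: divide_pos_pos)
    have moment: "(\<integral>\<^sup>+\<beta>. ennreal (remaining \<beta> n) \<partial>sticks k) =
        ennreal (\<Prod>j<n. Beta (?a + real 0) (?b j + real 1) / Beta ?a (?b j))"
      using sticks_moments[OF k, where J = n and A = "\<lambda>_. 0" and B = "\<lambda>_. 1"]
      by (simp add: remaining_def)
    \<comment> \<open>The factors are (j + 2) / (k + j + 1); as \<open>k \<ge> 2\<close> they are at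
      most (j + 2) / (j + 3), whose product telescopes to 2 / (n + 2).\<close>
    have le: "(\<Prod>j<n. Beta (?a + real 0) (?b j + real 1) / Beta ?a (?b j)) \<le>
        (\<Prod>j<n. (real j + 2) / (real j + 3))"
    proof (rule prod_mono)
      fix j
      have "Beta ?a (?b j) \<noteq> 0" using Beta_real_pos[OF pos(1) pos(2)[of j]] by simp
      then have "Beta (?a + real 0) (?b j + real 1) / Beta ?a (?b j) = ?b j / (?a + ?b j)"
        using Beta_Suc_right[OF pos] by simp
      moreover have "?a + ?b j = (real k + real j + 1) / real k"
        by (simp add: add_divide_distrib[symmetric])
      then have "?b j / (?a + ?b j) = (real j + 2) / (real k + real j + 1)"
        using k by simp
      ultimately have eq: "Beta (?a + real 0) (?b j + real 1) / Beta ?a (?b j) = (real j + 2) / (real k + real j + 1)"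
        by (simp only:)
      show "0 \<le> Beta (?a + real 0) (?b j + real 1) / Beta ?a (?b j) \<and>
          Beta (?a + real 0) (?b j + real 1) / Beta ?a (?b j) \<le> (real j + 2) / (real j + 3)"
        unfolding eq using k by (simp add: frac_le)
    qed
    have telescope: "(\<Prod>j<n. (real j + 2) / (real j + 3)) = 2 / (real n + 2)"
      by (induction n) (auto simp: field_simps)
    show ?thesis
      unfolding moment telescope[symmetric] by (rule ennreal_leI[OF le])
  qed
  \<comment> \<open>The infimum is below every remainder at every point, before monotonicity is
    available almost surely; there it becomes the limit.\<close>
  let ?I = "\<lambda>\<beta>. INF n. ennreal (remaining \<beta> n)"
  have "(\<integral>\<^sup>+\<beta>. ?I \<beta> \<partial>sticks k) \<le> ennreal (2 / (real n + 2))" for n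
    by (rule order_trans[OF nn_integral_mono E]) (auto intro: INF_lower)
  moreover have "(\<lambda>n. ennreal (2 / (real n + 2))) \<longlonglongrightarrow> ennreal 0"
  proof (intro tendsto_ennrealI)
    have "(\<lambda>n. 2 / real (n + 2)) \<longlonglongrightarrow> 0"
      by (rule LIMSEQ_ignore_initial_segment[OF lim_const_over_n])
    then show "(\<lambda>n. 2 / (real n + 2)) \<longlonglongrightarrow> 0" by (simp add: add.commute)
  qed
  ultimately have "(\<integral>\<^sup>+\<beta>. ?I \<beta> \<partial>sticks k) \<le> ennreal 0"
    by (intro LIMSEQ_le_const) auto
  then have "AE \<beta> in sticks k. ?I \<beta> = 0"
    by (subst (asm) ennreal_0) (simp add: nn_integral_0_iff_AE del: of_nat_Suc)
  with AE_sticks[OF k] show ?thesis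
  proof eventually_elim
    case (elim \<beta>)
    have nonneg: "0 \<le> remaining \<beta> n" for n
      unfolding remaining_def using elim(1) by (intro prod_nonneg) (auto simp: less_imp_le)
    have "decseq (remaining \<beta>)"
    proof (rule decseq_SucI)
      fix n
      have "remaining \<beta> (Suc n) = remaining \<beta> n * (1 - \<beta> n)" by (simp add: remaining_def)
      also have "\<dots> \<le> remaining \<beta> n * 1"
        using elim(1) nonneg by (intro mult_left_mono) (auto simp: less_imp_le)
      finally show "remaining \<beta> (Suc n) \<le> remaining \<beta> n" by simp
    qed
    then have "decseq (\<lambda>n. ennreal (remaining \<beta> n))"
      by (auto simp: decseq_def intro: ennreal_leI)
    from LIMSEQ_INF[OF this] elim(2) have "(\<lambda>n. ennreal (remaining \<beta> n)) \<longlonglongrightarrow> ennreal 0" by simp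
    then show ?case using nonneg by (subst (asm) tendsto_ennreal_iff) auto
  qed
qed

section \<open>Sampling from a broken stick\<close>

abbreviation uniform01 :: "real measure" where
  "uniform01 \<equiv> uniform_measure lborel {0..<1}"

lemma prob_space_uniform01: "prob_space uniform01"
  by (rule prob_space_uniform_measure) auto

lemma emeasure_uniform01:
  assumes "A \<in> sets borel"
  shows "emeasure uniform01 A = emeasure lborel ({0..<1} \<inter> A)"
  using assms by (simp add: emeasure_uniform_measure divide_ennreal_def)

text \<open>\<open>pick R u b\<close> cuts \<open>[0, 1)\<close> at the points \<open>R 1 \<ge> \<dots> \<ge> R b\<close> and numbers the resulting
  \<open>b + 1\<close> intervals from right to left.\<close>

definition pick :: "(nat \<Rightarrow> real) \<Rightarrow> real \<Rightarrow> nat \<Rightarrow> nat" where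
  "pick R u b = (LEAST j. j = b \<or> R (Suc j) \<le> u)"

text \<open>By monotonicity of \<open>R\<close>, having passed all cuts before \<open>i\<close>
  reduces to the single inequality \<open>u < R i\<close>.\<close>

lemma pick_eq_iff:
  assumes "antimono R" "u < R 0"
  shows "pick R u b = i \<longleftrightarrow> (i < b \<and> R (Suc i) \<le> u \<and> u < R i) \<or> (i = b \<and> u < R b)"
proof -
  have lt: "(\<forall>j<i. u < R (Suc j)) \<longleftrightarrow> u < R i" for i
  proof
    assume "\<forall>j<i. u < R (Suc j)"
    then show "u < R i" using assms(2) by (cases i) auto
  next
    assume u: "u < R i"
    show "\<forall>j<i. u < R (Suc j)"
    proof (intro allI impI)
      fix j assume "j < i"
      then have "R i \<le> R (Suc j)" using assms(1) by (auto simp: antimono_def)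
      then show "u < R (Suc j)" using u by linarith
    qed
  qed
  have "pick R u b = i \<longleftrightarrow> (i = b \<or> R (Suc i) \<le> u) \<and> (\<forall>j<i. \<not> (j = b \<or> R (Suc j) \<le> u))"
  proof
    assume i: "pick R u b = i"
    have "pick R u b = b \<or> R (Suc (pick R u b)) \<le> u"
      unfolding pick_def by (rule LeastI[of _ b]) simp
    moreover have "\<not> (j = b \<or> R (Suc j) \<le> u)" if "j < pick R u b" for j
      using that unfolding pick_def by (rule not_less_Least)
    ultimately show "(i = b \<or> R (Suc i) \<le> u) \<and> (\<forall>j<i. \<not> (j = b \<or> R (Suc j) \<le> u))"
      unfolding i by blast
  next
    assume "(i = b \<or> R (Suc i) \<le> u) \<and> (\<forall>j<i. \<not> (j = b \<or> R (Suc j) \<le> u))"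
    then show "pick R u b = i"
      unfolding pick_def by (intro Least_equality) (auto simp: not_less[symmetric])
  qed
  also have "\<dots> \<longleftrightarrow> (i = b \<or> R (Suc i) \<le> u) \<and> i \<le> b \<and> (\<forall>j<i. u < R (Suc j))"
    by (auto simp: not_le not_less[symmetric])
  also have "\<dots> \<longleftrightarrow> (i < b \<and> R (Suc i) \<le> u \<and> u < R i) \<or> (i = b \<and> u < R b)"
    unfolding lt by (cases "i = b") auto
  finally show ?thesis .
qed

text \<open>Carried in the recursion because the next label depends on how many are in use; the
  start value 1 accounts for label 0 of the initial string.\<close>

primrec paint_bound :: "(nat \<Rightarrow> real) \<Rightarrow> (nat \<Rightarrow> real) \<Rightarrow> nat \<Rightarrow> nat" where
  "paint_bound R U 0 = 1"
| "paint_bound R U (Suc n) = max (paint_bound R U n) (Suc (pick R (U n) (paint_bound R U n)))"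

definition paint_seq :: "(nat \<Rightarrow> real) \<Rightarrow> (nat \<Rightarrow> real) \<Rightarrow> nat \<Rightarrow> nat" where
  "paint_seq R U n = pick R (U n) (paint_bound R U n)"

lemma paint_bound_eq: "paint_bound R U n = label_bound (paint_seq R U) n"
  by (induction n) (auto simp: paint_seq_def)

text \<open>Once the prefix is prescribed, the bounds are known numbers and each condition involves
  one \<open>U m\<close> only. This removes the feedback and yields a cylinder event.\<close>

lemma paint_seq_eq_iff:
  "(\<forall>m<n. paint_seq R U m = x m) \<longleftrightarrow> (\<forall>m<n. pick R (U m) (label_bound x m) = x m)"
proof (induction n)
  case (Suc n)
  have "paint_seq R U n = pick R (U n) (label_bound x n)" if "\<forall>m<n. paint_seq R U m = x m"
  proof -
    have "paint_bound R U n = label_bound x n"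
      unfolding paint_bound_eq using that by (intro label_bound_cong) simp
    then show ?thesis by (simp only: paint_seq_def)
  qed
  then show ?case using Suc by (auto simp: less_Suc_eq)
qed simp

lemma borel_measurable_remaining [measurable (raw)]:
  assumes "\<And>i. (\<lambda>z. \<beta> z i) \<in> borel_measurable M"
  shows "(\<lambda>z. remaining (\<beta> z) j) \<in> borel_measurable M"
  using assms unfolding remaining_def by measurable

lemma measurable_pick:
  assumes [measurable]: "\<And>j. (\<lambda>z. R z j) \<in> borel_measurable M" "u \<in> borel_measurable M"
  shows "(\<lambda>z. pick (R z) (u z) b) \<in> M \<rightarrow>\<^sub>M count_space UNIV"
  unfolding pick_def by measurable

lemma measurable_paint_seq:
  assumes "\<And>j. (\<lambda>z. R z j) \<in> borel_measurable M" "\<And>m. (\<lambda>z. U z m) \<in> borel_measurable M"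
  shows "(\<lambda>z. paint_seq (R z) (U z) n) \<in> M \<rightarrow>\<^sub>M count_space UNIV"
proof -
  have *: "(\<lambda>z. pick (R z) (U z m) (b z)) \<in> M \<rightarrow>\<^sub>M count_space UNIV"
    if "b \<in> M \<rightarrow>\<^sub>M count_space UNIV" for b m
    by (rule measurable_compose_countable[OF measurable_pick that]) (use assms in auto)
  have "(\<lambda>z. paint_bound (R z) (U z) n) \<in> M \<rightarrow>\<^sub>M count_space UNIV" for n
  proof (induction n)
    case (Suc n)
    note [measurable] = Suc *[OF Suc]
    show ?case by simp
  qed simp
  then show ?thesis unfolding paint_seq_def by (rule *)
qed

lemma emeasure_pick:
  assumes R: "antimono R" "R 0 = 1" "\<And>j. 0 \<le> R j"
  shows "emeasure uniform01 {u. pick R u b = i} =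
    ennreal (if i < b then R i - R (Suc i) else if i = b then R b else 0)"
proof -
  have le1: "R j \<le> 1" for j using R(1,2) by (metis antimonoD le0)
  have le: "R (Suc j) \<le> R j" for j using R(1) by (simp add: antimonoD)
  have "(\<lambda>u. pick R u b) \<in> borel \<rightarrow>\<^sub>M count_space UNIV"
    by (rule measurable_pick) auto
  then have "{u. pick R u b = i} \<in> sets borel"
    using measurable_sets[of "\<lambda>u. pick R u b" borel "count_space UNIV" "{i}"] by (simp add: vimage_def)
  then have "emeasure uniform01 {u. pick R u b = i} = emeasure lborel ({0..<1} \<inter> {u. pick R u b = i})"
    by (rule emeasure_uniform01)
  also have "{0..<1} \<inter> {u. pick R u b = i} =
      (if i < b then {R (Suc i)..<R i} else if i = b then {0..<R b} else {})"
    using pick_eq_iff[OF R(1), of _ b i] R(2) R(3)[of "Suc i"] le1[of i]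
    by (auto, fastforce+)
  also have "emeasure lborel \<dots> = ennreal (if i < b then R i - R (Suc i) else if i = b then R b else 0)"
    using le R(3) by simp
  finally show ?thesis .
qed

abbreviation uniforms :: "(nat \<Rightarrow> real) measure" where
  "uniforms \<equiv> \<Pi>\<^sub>M m\<in>UNIV. uniform01"

lemma prob_space_uniforms: "prob_space uniforms"
  by (intro prob_space_PiM prob_space_uniform01)

lemma AE_uniforms: "AE U in uniforms. \<forall>m. 0 \<le> U m \<and> U m < 1"
proof -
  have "AE u in uniform01. 0 \<le> u \<and> u < 1"
    by (rule AE_uniform_measureI) auto
  then have "AE U in uniforms. 0 \<le> U m \<and> U m < 1" for m
    by (intro AE_PiM_component[of UNIV _ m] prob_space_uniform01) auto
  then show ?thesis by (simp add: AE_all_countable)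
qed

lemma emeasure_paint_seq:
  assumes R: "antimono R" "R 0 = 1" "\<And>j. 0 \<le> R j"
  shows "emeasure uniforms {U \<in> space uniforms. \<forall>m<n. paint_seq R U m = x m} =
    ennreal (\<Prod>m<n. sampling_prob R x m)"
proof -
  interpret product_prob_space "\<lambda>_ :: nat. uniform01" UNIV
    by (rule product_prob_spaceI) (rule prob_space_uniform01)
  let ?A = "\<lambda>m. {u. pick R u (label_bound x m) = x m}"
  have A: "?A m \<in> sets uniform01" for m
  proof -
    have "(\<lambda>u. pick R u (label_bound x m)) \<in> borel \<rightarrow>\<^sub>M count_space UNIV"
      by (rule measurable_pick) auto
    then show ?thesis
      using measurable_sets[of "\<lambda>u. pick R u (label_bound x m)" borel "count_space UNIV" "{x m}"]
      by (simp add: vimage_def)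
  qed
  have "{U \<in> space uniforms. \<forall>m<n. paint_seq R U m = x m} = {U \<in> space uniforms. \<forall>m\<in>{..<n}. U m \<in> ?A m}"
    unfolding paint_seq_eq_iff by (simp only: Ball_def lessThan_iff mem_Collect_eq)
  also have "emeasure uniforms \<dots> = (\<Prod>m<n. emeasure uniform01 (?A m))"
    using A by (intro emeasure_PiM_Collect) auto
  also have "\<dots> = (\<Prod>m<n. ennreal (sampling_prob R x m))"
    unfolding emeasure_pick[OF R] by (intro prod.cong refl) (auto simp: sampling_prob_def)
  also have "\<dots> = ennreal (\<Prod>m<n. sampling_prob R x m)"
    using R by (intro prod_ennreal) (auto simp: sampling_prob_def antimonoD)
  finally show ?thesis .
qed

text \<open>Used with \<open>r\<close> a remainder of the stick: unlike the choice of a label, the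
  event \<open>U m < r\<close> does not involve the labels used so far.\<close>

lemma uniforms_strong_law:
  assumes r: "0 \<le> r" "r \<le> 1"
  shows "AE U in uniforms. (\<lambda>n. (\<Sum>m<n. of_bool (U m < r)) / real n) \<longlonglongrightarrow> r"
proof -
  interpret prob_space uniforms by (rule prob_space_uniforms)
  define X where "X m U = (of_bool (U m < r) :: real)" for m :: nat and U
  have [measurable]: "X m \<in> borel_measurable uniforms" for m unfolding X_def by measurable
  have ind: "indep_vars (\<lambda>_. borel) X UNIV"
    unfolding X_def
    by (rule indep_vars_compose2[OF indep_vars_PiM_coordinates[OF prob_space_uniform01]]) measurable
  have E: "expectation (X m) = r" for m
  proof -
    have "uniform01 = distr uniforms uniform01 (\<lambda>U. U m)"
      by (intro distr_PiM_component[symmetric] prob_space_uniform01) auto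
    then have "prob {U \<in> space uniforms. U m < r} = measure uniform01 {..<r}"
      using measure_distr[of "\<lambda>U. U m" uniforms uniform01 "{..<r}"]
      by (simp add: vimage_def Int_def conj_commute)
    also have "\<dots> = r"
    proof -
      have "{0..<1} \<inter> {..<r} = {0..<r}" using r by auto
      then show ?thesis using r emeasure_uniform01[of "{..<r}"] by (simp add: measure_def)
    qed
    also have "prob {U \<in> space uniforms. U m < r} = expectation (indicator {U \<in> space uniforms. U m < r})"
      by (subst Bochner_Integration.integral_indicator) auto
    also have "\<dots> = expectation (X m)"
      by (intro Bochner_Integration.integral_cong) (auto simp: X_def indicator_def)
    finally show ?thesis by simp
  qed
  have "AE U in uniforms. \<forall>\<^sub>F n in sequentially. \<bar>(\<Sum>m<n. X m U) / real n - r\<bar> < e" if e: "e > 0" for e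
  proof -
    define A where "A n = {U \<in> space uniforms. real n * e \<le> \<bar>(\<Sum>m<n. X m U) - real n * r\<bar>}" for n
    have A [measurable]: "A n \<in> events" for n unfolding A_def by measurable
    have bound: "prob (A n) \<le> 2 * exp (- 2 * e\<^sup>2) ^ n" if "n > 0" for n
    proof -
      interpret H: Hoeffding_ineq uniforms "{..<n}" X "\<lambda>_. 0" "\<lambda>_. 1" "real n * r"
      proof unfold_locales
        show "indep_vars (\<lambda>_. borel) X {..<n}" by (rule indep_vars_subset[OF ind]) auto
        show "real n * r \<equiv> \<Sum>i<n. expectation (X i)" by (simp add: E)
      qed (auto simp: X_def)
      \<comment> \<open>Hoeffding for \<open>n\<close> variables in an interval of length 1 and
        deviation \<open>n * e\<close>; the bound is a geometric sequence.\<close>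
      have "prob (A n) \<le> 2 * exp (- 2 * (real n * e)\<^sup>2 / (\<Sum>i<n. (1 - 0)\<^sup>2))"
        unfolding A_def using H.Hoeffding_ineq_abs_ge[of "real n * e"] e that by simp
      also have "- 2 * (real n * e)\<^sup>2 / (\<Sum>i<n. (1 - 0)\<^sup>2) = real n * (- 2 * e\<^sup>2)"
        using that by (simp add: power2_eq_square)
      finally show ?thesis by (simp only: exp_of_nat_mult)
    qed
    have "exp (- 2 * e\<^sup>2) < 1" using e by simp
    then have "summable (\<lambda>n. 2 * exp (- 2 * e\<^sup>2) ^ n)"
      by (intro summable_mult summable_geometric) simp
    then have "summable (\<lambda>n. prob (A n))"
    proof (rule summable_comparison_test'[where N = 1])
      fix n :: nat assume "1 \<le> n"
      then show "norm (prob (A n)) \<le> 2 * exp (- 2 * e\<^sup>2) ^ n" using bound[of n] by simp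
    qed
    then have "AE U in uniforms. \<forall>\<^sub>F n in sequentially. U \<in> space uniforms - A n"
      by (intro borel_cantelli_AE1 A) (auto simp: less_top[symmetric])
    then show ?thesis
    proof eventually_elim
      case (elim U)
      with eventually_gt_at_top[of 0] show ?case
      proof eventually_elim
        case (elim n)
        then have "\<bar>(\<Sum>m<n. X m U) - real n * r\<bar> < real n * e" by (auto simp: A_def)
        moreover have "\<bar>(\<Sum>m<n. X m U) / real n - r\<bar> = \<bar>(\<Sum>m<n. X m U) - real n * r\<bar> / real n"
        proof -
          have "(\<Sum>m<n. X m U) / real n - r = ((\<Sum>m<n. X m U) - real n * r) / real n"
            using elim by (simp add: field_simps)
          then show ?thesis by simp
        qed
        ultimately show ?case using elim by (simp add: field_simps)
      qed
    qed
  qed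
  \<comment> \<open>Countably many tolerances, so that one null set serves for all.\<close>
  then have "AE U in uniforms. \<forall>q. \<forall>\<^sub>F n in sequentially. \<bar>(\<Sum>m<n. X m U) / real n - r\<bar> < inverse (real (Suc q))"
    by (subst AE_all_countable) simp
  then show ?thesis
  proof eventually_elim
    case (elim U)
    show ?case
    proof (rule tendstoI)
      fix e :: real assume "e > 0"
      then obtain q where "inverse (real (Suc q)) < e" using reals_Archimedean by blast
      then show "\<forall>\<^sub>F n in sequentially. dist ((\<Sum>m<n. of_bool (U m < r)) / real n) r < e"
        using elim by (auto simp: dist_real_def X_def elim!: eventually_mono dest!: spec[of _ q])
    qed
  qed
qed

lemma paint_bound_mono: "incseq (paint_bound R U)"
  by (rule incseq_SucI) simp

text \<open>From some time on label \<open>j\<close> is in use. After that it is chosen exactly when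
  \<open>U m\<close> falls into its own piece, so its count differs from a difference of two
  threshold counts by a constant.\<close>

lemma paint_seq_freq:
  assumes R: "antimono R" "R 0 = 1" "\<And>j. 0 < R j"
    and U: "\<And>m. 0 \<le> U m" "\<And>m. U m < 1"
    and lim: "\<And>j. (\<lambda>n. (\<Sum>m<n. of_bool (U m < R j)) / real n) \<longlonglongrightarrow> R j"
  shows "(\<lambda>n. label_freq (paint_seq R U) n j) \<longlonglongrightarrow> R j - R (Suc j)"
proof -
  have pick: "pick R (U m) b = i \<longleftrightarrow> (i < b \<and> R (Suc i) \<le> U m \<and> U m < R i) \<or> (i = b \<and> U m < R b)"
    for m b i using pick_eq_iff[OF R(1)] U R(2) by simp
  \<comment> \<open>Otherwise the threshold count would be eventually constant and its frequency
    would tend to 0, not to \<open>R j > 0\<close>.\<close>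
  have inf: "\<exists>m\<ge>N. U m < R j" for N j
  proof (rule ccontr)
    assume none: "\<not> (\<exists>m\<ge>N. U m < R j)"
    define c :: real where "c = (\<Sum>m<N. of_bool (U m < R j))"
    have "(\<Sum>m<n. of_bool (U m < R j)) = c" if "n \<ge> N" for n
      unfolding c_def using none that by (intro sum.mono_neutral_right) auto
    then have "eventually (\<lambda>n. c / real n = (\<Sum>m<n. of_bool (U m < R j)) / real n) sequentially"
      by (auto simp: eventually_sequentially intro!: exI[of _ N])
    then have "(\<lambda>n. (\<Sum>m<n. of_bool (U m < R j)) / real n) \<longlonglongrightarrow> 0"
      by (rule Lim_transform_eventually[rotated]) (rule lim_const_over_n)
    from LIMSEQ_unique[OF lim[of j] this] show False using R(3)[of j] by simp
  qed
  \<comment> \<open>With \<open>b\<close> labels in use, any later \<open>U m < R b\<close> creates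
    a new one.\<close>
  have unbounded: "\<exists>N. b \<le> paint_bound R U N" for b
  proof (induction b)
    case (Suc b)
    then obtain N where N: "b \<le> paint_bound R U N" by blast
    obtain m where m: "m \<ge> N" "U m < R b" using inf by blast
    have "b \<le> paint_bound R U m" using N incseqD[OF paint_bound_mono m(1)] by (rule order_trans)
    then consider "Suc b \<le> paint_bound R U m" | "paint_bound R U m = b" by linarith
    then show ?case
    proof cases
      case 2
      then have "pick R (U m) (paint_bound R U m) = b" using pick m by simp
      then have "Suc b \<le> paint_bound R U (Suc m)" by simp
      then show ?thesis by blast
    qed blast
  qed simp
  obtain N where N: "Suc j \<le> paint_bound R U N" using unbounded by blast
  define f :: "nat \<Rightarrow> real" where "f m = of_bool (U m < R j) - of_bool (U m < R (Suc j))" for m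
  define c :: real where "c = (\<Sum>m<N. of_bool (paint_seq R U m = j) - f m)"
  have late: "of_bool (paint_seq R U m = j) = f m" if "m \<ge> N" for m
  proof -
    have "j < paint_bound R U m" using N incseqD[OF paint_bound_mono that, of R U] by simp
    moreover have "R (Suc j) \<le> R j" using R(1) by (simp add: antimonoD)
    ultimately show ?thesis using pick[of m "paint_bound R U m" j] by (auto simp: paint_seq_def f_def)
  qed
  have sum: "(\<Sum>m<n. of_bool (paint_seq R U m = j)) = c + (\<Sum>m<n. f m)" if "n \<ge> N" for n
  proof -
    have "(\<Sum>m<n. of_bool (paint_seq R U m = j) - f m) = c"
      unfolding c_def using late that by (intro sum.mono_neutral_right) auto
    then show ?thesis by (simp add: sum_subtractf)
  qed
  have f: "(\<lambda>n. (\<Sum>m<n. f m) / real n) \<longlonglongrightarrow> R j - R (Suc j)"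
    using tendsto_diff[OF lim[of j] lim[of "Suc j"]] by (simp add: f_def sum_subtractf diff_divide_distrib)
  \<comment> \<open>The frequency is over \<open>n + 1\<close> strings, the initial one included,
    while the sums have \<open>n\<close> terms.\<close>
  have "(\<lambda>n. (\<Sum>m<n. f m) / real n * (real n / real (Suc n)) + (of_bool (j = 0) + c) / real (Suc n))
      \<longlonglongrightarrow> (R j - R (Suc j)) * 1 + 0"
    by (intro tendsto_add tendsto_mult f LIMSEQ_n_over_Suc_n
        filterlim_compose[OF lim_const_over_n filterlim_Suc])
  moreover have "\<forall>\<^sub>F n in sequentially. (\<Sum>m<n. f m) / real n * (real n / real (Suc n)) + (of_bool (j = 0) + c) / real (Suc n) =
      label_freq (paint_seq R U) n j"
    using eventually_ge_at_top[of N] eventually_gt_at_top[of 0]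
  proof eventually_elim
    case (elim n)
    have "label_freq (paint_seq R U) n j = (of_bool (j = 0) + (c + (\<Sum>m<n. f m))) / real (Suc n)"
      unfolding label_freq_def label_count_eq_sum sum[OF elim(1)] ..
    then show ?case using elim by (simp add: add_divide_distrib del: of_nat_Suc)
  qed
  ultimately show ?thesis by (simp add: Lim_transform_eventually)
qed

section \<open>Transfer to Stirling permutations\<close>

lemma measurable_prefix:
  fixes Z :: "'a \<Rightarrow> nat \<Rightarrow> 'c :: countable"
  assumes Z: "\<And>m. (\<lambda>z. Z z m) \<in> M \<rightarrow>\<^sub>M count_space UNIV"
  shows "(\<lambda>z. map (Z z) [0..<n]) \<in> M \<rightarrow>\<^sub>M count_space UNIV"
proof (induction n)
  case (Suc n)
  note [measurable] = Suc Z
  show ?case by simp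
qed simp

lemma emeasure_distr_prefix_single:
  fixes Z :: "'a \<Rightarrow> nat \<Rightarrow> 'c :: countable"
  assumes Z: "\<And>m. (\<lambda>z. Z z m) \<in> M \<rightarrow>\<^sub>M count_space UNIV"
  shows "emeasure (distr M (count_space UNIV) (\<lambda>z. map (Z z) [0..<n])) {l} =
      (if length l = n then emeasure M {z \<in> space M. \<forall>m<n. Z z m = l ! m} else 0)"
proof -
  have "map (Z z) [0..<n] = l \<longleftrightarrow> length l = n \<and> (\<forall>m<n. Z z m = l ! m)" for z
    unfolding list_eq_iff_nth_eq by auto
  then have "(\<lambda>z. map (Z z) [0..<n]) -` {l} \<inter> space M =
      (if length l = n then {z \<in> space M. \<forall>m<n. Z z m = l ! m} else {})"
    by (auto simp only: vimage_def Int_def mem_Collect_eq singleton_iff simp_thms if_True if_False split: if_splits)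
  then show ?thesis
    by (subst emeasure_distr[OF measurable_prefix[OF Z]]) simp_all
qed

lemma emeasure_distr_cylinder:
  fixes Z :: "'a \<Rightarrow> nat \<Rightarrow> 'c :: countable"
  assumes Z: "\<And>m. (\<lambda>z. Z z m) \<in> M \<rightarrow>\<^sub>M count_space UNIV" and J: "\<And>j. j \<in> J \<Longrightarrow> j < n"
  shows "emeasure (distr M (\<Pi>\<^sub>M m\<in>UNIV. count_space UNIV) Z) (prod_emb UNIV (\<lambda>_. count_space UNIV) J (Pi\<^sub>E J A)) =
      emeasure (distr M (count_space UNIV) (\<lambda>z. map (Z z) [0..<n])) {l. \<forall>j\<in>J. l ! j \<in> A j}"
proof -
  have ZM: "Z \<in> M \<rightarrow>\<^sub>M (\<Pi>\<^sub>M m\<in>UNIV. count_space UNIV)"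
    by (rule measurable_PiM_single') (use Z in \<open>auto simp: space_PiM\<close>)
  have "finite J" using J by (auto simp: finite_nat_set_iff_bounded)
  then have sets: "prod_emb UNIV (\<lambda>_. count_space UNIV) J (Pi\<^sub>E J A) \<in> sets (\<Pi>\<^sub>M m\<in>UNIV. count_space UNIV)"
    by (intro sets_PiM_I) auto
  have "Z -` prod_emb UNIV (\<lambda>_. count_space UNIV) J (Pi\<^sub>E J A) \<inter> space M =
      (\<lambda>z. map (Z z) [0..<n]) -` {l. \<forall>j\<in>J. l ! j \<in> A j} \<inter> space M"
    using J by (auto simp: prod_emb_def PiE_iff)
  then show ?thesis
    by (simp add: emeasure_distr[OF measurable_prefix[OF Z]] emeasure_distr[OF ZM sets])
qed

text \<open>A finite cylinder is an event about a sufficiently long prefix, and prefixes live in a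
  countable space, where a law is fixed by its singletons.\<close>

lemma distr_eq_of_prefixes:
  fixes X :: "'a \<Rightarrow> nat \<Rightarrow> 'c :: countable" and Y :: "'b \<Rightarrow> nat \<Rightarrow> 'c"
  assumes M: "prob_space M"
    and X: "\<And>m. (\<lambda>z. X z m) \<in> M \<rightarrow>\<^sub>M count_space UNIV"
    and Y: "\<And>m. (\<lambda>z. Y z m) \<in> N \<rightarrow>\<^sub>M count_space UNIV"
    and eq: "\<And>n x. emeasure M {z \<in> space M. \<forall>m<n. X z m = x m} =
      emeasure N {z \<in> space N. \<forall>m<n. Y z m = x m}"
  shows "distr M (\<Pi>\<^sub>M m\<in>UNIV. count_space UNIV) X = distr N (\<Pi>\<^sub>M m\<in>UNIV. count_space UNIV) Y"
proof (rule measure_eqI_PiM_infinite)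
  have "X \<in> M \<rightarrow>\<^sub>M (\<Pi>\<^sub>M m\<in>UNIV. count_space UNIV)"
    by (rule measurable_PiM_single') (use X in \<open>auto simp: space_PiM\<close>)
  then show "finite_measure (distr M (\<Pi>\<^sub>M m\<in>UNIV. count_space UNIV) X)"
    by (intro prob_space.finite_measure prob_space.prob_space_distr M)
  have lists: "distr M (count_space UNIV) (\<lambda>z. map (X z) [0..<n]) = distr N (count_space UNIV) (\<lambda>z. map (Y z) [0..<n])" for n
    by (rule measure_eqI_countable[of _ UNIV])
      (auto simp: emeasure_distr_prefix_single[OF X] emeasure_distr_prefix_single[OF Y] eq)
  fix A :: "nat \<Rightarrow> 'c set" and J :: "nat set"
  assume J: "finite J"
  then obtain n where n: "\<And>j. j \<in> J \<Longrightarrow> j < n" unfolding finite_nat_set_iff_bounded by blast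
  show "emeasure (distr M (\<Pi>\<^sub>M m\<in>UNIV. count_space UNIV) X) (prod_emb UNIV (\<lambda>_. count_space UNIV) J (Pi\<^sub>E J A)) =
      emeasure (distr N (\<Pi>\<^sub>M m\<in>UNIV. count_space UNIV) Y) (prod_emb UNIV (\<lambda>_. count_space UNIV) J (Pi\<^sub>E J A))"
    using emeasure_distr_cylinder[of X M J n A, OF X n] emeasure_distr_cylinder[of Y N J n A, OF Y n]
    by (simp only: lists)
qed auto

section \<open>Label sequences with limiting frequencies\<close>

definition limit_freq :: "(nat \<Rightarrow> nat) \<Rightarrow> nat \<Rightarrow> real" where
  "limit_freq x j = lim (\<lambda>n. label_freq x n j)"

text \<open>Stated with the Cauchy property and an extended nonnegative sum because these are
  evidently measurable. Positivity ensures that the limits can be ranked.\<close>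

definition regular :: "(nat \<Rightarrow> nat) \<Rightarrow> bool" where
  "regular x \<longleftrightarrow> (\<forall>j. Cauchy (\<lambda>n. label_freq x n j)) \<and> (\<forall>j. 0 < limit_freq x j) \<and>
     (\<Sum>j. ennreal (limit_freq x j)) = 1"

lemma regularD:
  assumes "regular x"
  shows "(\<lambda>n. label_freq x n j) \<longlonglongrightarrow> limit_freq x j" "0 < limit_freq x j"
    "limit_freq x sums 1" "rearrangeable (limit_freq x)"
proof -
  have pos: "0 < limit_freq x j" for j using assms by (simp add: regular_def)
  then show "0 < limit_freq x j" .
  have "convergent (\<lambda>n. label_freq x n j)" using assms by (simp add: regular_def Cauchy_convergent)
  then show "(\<lambda>n. label_freq x n j) \<longlonglongrightarrow> limit_freq x j"
    by (simp add: limit_freq_def convergent_LIMSEQ_iff)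
  have sum: "(\<Sum>j. ennreal (limit_freq x j)) = 1" using assms by (simp add: regular_def)
  then have summable: "summable (limit_freq x)"
    using pos by (intro summable_suminf_not_top) (auto simp: less_imp_le)
  then have "ennreal (suminf (limit_freq x)) = 1"
    using sum pos by (subst (asm) suminf_ennreal2) (auto simp: less_imp_le)
  then have "suminf (limit_freq x) = 1"
    by simp
  then show "limit_freq x sums 1" using summable by (simp add: sums_iff)
  show "rearrangeable (limit_freq x)"
    by (rule rearrangeable_pos_null[OF pos summable_LIMSEQ_zero[OF summable]])
qed

lemma regularI:
  assumes "\<And>j. (\<lambda>n. label_freq x n j) \<longlonglongrightarrow> p j" "\<And>j. 0 < p j" "p sums 1"
  shows "regular x" "limit_freq x = p"
proof -
  have eq: "limit_freq x j = p j" for j unfolding limit_freq_def by (rule limI[OF assms(1)])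
  then show "limit_freq x = p" by auto
  have "(\<Sum>j. ennreal (p j)) = ennreal 1"
    using assms(2,3) by (intro suminf_ennreal_eq) (auto simp: less_imp_le)
  then show "regular x"
    using assms LIMSEQ_imp_Cauchy[OF assms(1)] by (simp add: regular_def eq)
qed

lemma measurable_label_freq [measurable]:
  "(\<lambda>x. label_freq x n j) \<in> borel_measurable (\<Pi>\<^sub>M m\<in>UNIV. count_space UNIV)"
  unfolding label_freq_def label_count_eq_sum by measurable

lemma measurable_limit_freq_component [measurable]:
  "(\<lambda>x. limit_freq x j) \<in> borel_measurable (\<Pi>\<^sub>M m\<in>UNIV. count_space UNIV)"
  unfolding limit_freq_def by measurable

lemma measurable_limit_freq [measurable]:
  "limit_freq \<in> (\<Pi>\<^sub>M m\<in>UNIV. count_space UNIV) \<rightarrow>\<^sub>M (\<Pi>\<^sub>M j\<in>UNIV. borel)"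
  by (rule measurable_PiM_single') (auto simp: space_PiM)

lemma measurable_ranked_limit_freq:
  "(\<lambda>x. decreasing_rearrangement (limit_freq x)) \<in>
    (\<Pi>\<^sub>M m\<in>UNIV. count_space UNIV) \<rightarrow>\<^sub>M (\<Pi>\<^sub>M j\<in>UNIV. borel)"
  by (rule measurable_compose[OF measurable_limit_freq measurable_decreasing_rearrangement])

lemma measurable_regular [measurable]:
  "Measurable.pred (\<Pi>\<^sub>M m\<in>UNIV. count_space UNIV) regular"
proof -
  let ?P = "\<Pi>\<^sub>M m\<in>(UNIV :: nat set). count_space (UNIV :: nat set)"
  have [measurable]: "Measurable.pred ?P (\<lambda>x. Cauchy (\<lambda>n. label_freq x n j))" for j
    unfolding pred_def by (rule sets_Collect_Cauchy) measurable
  have eq: "regular = (\<lambda>x. (\<forall>j. Cauchy (\<lambda>n. label_freq x n j)) \<and> (\<forall>j. 0 < limit_freq x j) \<and>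
     (\<Sum>j. ennreal (limit_freq x j)) = 1)" by (simp add: regular_def fun_eq_iff)
  show ?thesis unfolding eq by measurable
qed

section \<open>Sampling on the product of sticks and uniforms\<close>

abbreviation paint_space :: "nat \<Rightarrow> ((nat \<Rightarrow> real) \<times> (nat \<Rightarrow> real)) measure" where
  "paint_space k \<equiv> sticks k \<Otimes>\<^sub>M uniforms"

definition paint_labels :: "(nat \<Rightarrow> real) \<times> (nat \<Rightarrow> real) \<Rightarrow> nat \<Rightarrow> nat" where
  "paint_labels z = paint_seq (remaining (fst z)) (snd z)"

lemma measurable_paint_labels [measurable]:
  "(\<lambda>z. paint_labels z m) \<in> paint_space k \<rightarrow>\<^sub>M count_space UNIV"
  unfolding paint_labels_def
proof (rule measurable_paint_seq)
  show "(\<lambda>z. remaining (fst z) j) \<in> borel_measurable (paint_space k)" for j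
    by (rule borel_measurable_remaining) measurable
  show "(\<lambda>z. snd z m) \<in> borel_measurable (paint_space k)" for m
    by measurable
qed

lemma remaining_properties:
  assumes "\<forall>i. 0 < \<beta> i \<and> \<beta> i < 1"
  shows "antimono (remaining \<beta>)" "remaining \<beta> 0 = 1" "0 < remaining \<beta> j" "0 < stick_breaking \<beta> j"
proof -
  have pos: "0 < remaining \<beta> j" for j
    unfolding remaining_def using assms by (intro prod_pos) simp
  then show "0 < remaining \<beta> j" .
  show "remaining \<beta> 0 = 1" by (simp add: remaining_def)
  show stick: "0 < stick_breaking \<beta> j" for j
    using assms pos[of j] by (simp add: stick_breaking_def remaining_def)
  show "antimono (remaining \<beta>)"
  proof (rule decseq_SucI)
    show "remaining \<beta> (Suc n) \<le> remaining \<beta> n" for n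
      using stick[of n] by (simp add: stick_breaking_eq_diff)
  qed
qed

lemma emeasure_paint_labels:
  assumes k: "k \<ge> 2"
  shows "emeasure (paint_space k) {z \<in> space (paint_space k). \<forall>m<n. paint_labels z m = x m} =
    ennreal (\<Prod>m<n. label_prob k x m)"
proof -
  interpret S: prob_space "sticks k" by (rule prob_space_sticks[OF k])
  interpret U: prob_space uniforms by (rule prob_space_uniforms)
  let ?E = "{z \<in> space (paint_space k). \<forall>m<n. paint_labels z m = x m}"
  have "?E \<in> sets (paint_space k)" by measurable
  then have "emeasure (paint_space k) ?E = (\<integral>\<^sup>+\<beta>. emeasure uniforms (Pair \<beta> -` ?E) \<partial>sticks k)"
    by (rule U.emeasure_pair_measure_alt)
  also have "\<dots> = (\<integral>\<^sup>+\<beta>. ennreal (\<Prod>m<n. sampling_prob (remaining \<beta>) x m) \<partial>sticks k)"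
  proof (rule nn_integral_cong_AE)
    show "AE \<beta> in sticks k. emeasure uniforms (Pair \<beta> -` ?E) = ennreal (\<Prod>m<n. sampling_prob (remaining \<beta>) x m)"
      using AE_sticks[OF k] AE_space
    proof eventually_elim
      case (elim \<beta>)
      have "Pair \<beta> -` ?E = {U \<in> space uniforms. \<forall>m<n. paint_seq (remaining \<beta>) U m = x m}"
        using elim(2) by (auto simp: space_pair_measure paint_labels_def)
      then show ?case
        using emeasure_paint_seq[of "remaining \<beta>" n x] remaining_properties[OF elim(1)]
        by (simp add: less_imp_le)
    qed
  qed
  also have "\<dots> = ennreal (\<Prod>m<n. label_prob k x m)"
    by (rule nn_integral_sampling_prob[OF k])
  finally show ?thesis .
qed

lemma AE_paint_labels:
  assumes k: "k \<ge> 2"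
  shows "AE z in paint_space k. regular (paint_labels z) \<and> limit_freq (paint_labels z) = stick_breaking (fst z)"
proof -
  interpret S: prob_space "sticks k" by (rule prob_space_sticks[OF k])
  interpret U: prob_space uniforms by (rule prob_space_uniforms)
  interpret pair_sigma_finite "sticks k" uniforms ..
  have labels [measurable]: "paint_labels \<in> paint_space k \<rightarrow>\<^sub>M (\<Pi>\<^sub>M m\<in>UNIV. count_space UNIV)"
    by (rule measurable_PiM_single') (auto simp: space_PiM)
  have [measurable]: "(\<lambda>z. stick_breaking (fst z) j) \<in> borel_measurable (paint_space k)" for j
    unfolding stick_breaking_def by measurable
  \<comment> \<open>Equality of the sequences is stated coordinatewise to obtain a measurable event;
    then the sticks are fixed and the uniforms treated alone.\<close>
  have "AE z in paint_space k. regular (paint_labels z) \<and> (\<forall>j. limit_freq (paint_labels z) j = stick_breaking (fst z) j)"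
  proof (rule AE_pair_measure)
    show "{z \<in> space (paint_space k). regular (paint_labels z) \<and>
        (\<forall>j. limit_freq (paint_labels z) j = stick_breaking (fst z) j)} \<in> sets (paint_space k)"
      by measurable
    show "AE \<beta> in sticks k. AE U in uniforms. regular (paint_labels (\<beta>, U)) \<and>
        (\<forall>j. limit_freq (paint_labels (\<beta>, U)) j = stick_breaking (fst (\<beta>, U)) j)"
      using AE_sticks[OF k] AE_remaining_tendsto_0[OF k]
    proof eventually_elim
      case (elim \<beta>)
      note R = remaining_properties[OF elim(1)]
      have le1: "remaining \<beta> j \<le> 1" for j using R(1,2) by (metis antimonoD le0)
      have "AE U in uniforms. \<forall>j. (\<lambda>n. (\<Sum>m<n. of_bool (U m < remaining \<beta> j)) / real n) \<longlonglongrightarrow> remaining \<beta> j"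
        unfolding AE_all_countable using R(3) le1 by (intro allI uniforms_strong_law) (auto simp: less_imp_le)
      with AE_uniforms show ?case
      proof eventually_elim
        case (elim U)
        have freq: "(\<lambda>n. label_freq (paint_seq (remaining \<beta>) U) n j) \<longlonglongrightarrow> stick_breaking \<beta> j" for j
          unfolding stick_breaking_eq_diff using R elim by (intro paint_seq_freq) auto
        have "(\<lambda>n. remaining \<beta> n - remaining \<beta> (Suc n)) sums (remaining \<beta> 0 - 0)"
          by (rule telescope_sums') (rule \<open>remaining \<beta> \<longlonglongrightarrow> 0\<close>)
        then have "stick_breaking \<beta> sums 1" using R(2) by (simp add: stick_breaking_eq_diff[abs_def])
        from regularI[OF freq R(4) this] show ?case by (simp add: paint_labels_def)
      qed
    qed
  qed
  then show ?thesis by (rule eventually_mono) auto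
qed

lemma measurable_stick_breaking [measurable]:
  "stick_breaking \<in> (\<Pi>\<^sub>M i\<in>UNIV. borel) \<rightarrow>\<^sub>M (\<Pi>\<^sub>M i\<in>UNIV. borel)"
proof (rule measurable_PiM_single')
  show "(\<lambda>\<beta>. stick_breaking \<beta> i) \<in> borel_measurable (\<Pi>\<^sub>M i\<in>UNIV. borel)" for i
    unfolding stick_breaking_def by measurable
qed (auto simp: space_PiM)

lemma distr_paint_labels:
  assumes k: "k \<ge> 2"
  shows "distr (distr (paint_space k) (\<Pi>\<^sub>M m\<in>UNIV. count_space UNIV) paint_labels) (\<Pi>\<^sub>M i\<in>UNIV. borel)
      (\<lambda>x. decreasing_rearrangement (limit_freq x)) = poisson_dirichlet (1 / real k) (1 / real k)"
proof -
  interpret S: prob_space "sticks k" by (rule prob_space_sticks[OF k])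
  interpret U: prob_space uniforms by (rule prob_space_uniforms)
  let ?B = "\<Pi>\<^sub>M i\<in>(UNIV :: nat set). (borel :: real measure)"
  have labels [measurable]: "paint_labels \<in> paint_space k \<rightarrow>\<^sub>M (\<Pi>\<^sub>M m\<in>UNIV. count_space UNIV)"
    by (rule measurable_PiM_single') (auto simp: space_PiM)
  have sets: "sets (sticks k) = sets ?B" by (rule sets_PiM_cong) auto
  have rearr: "(\<lambda>\<beta>. decreasing_rearrangement (stick_breaking \<beta>)) \<in> sticks k \<rightarrow>\<^sub>M ?B"
    unfolding measurable_cong_sets[OF sets refl]
    by (rule measurable_compose[OF measurable_stick_breaking measurable_decreasing_rearrangement])
  have "distr (distr (paint_space k) (\<Pi>\<^sub>M m\<in>UNIV. count_space UNIV) paint_labels) ?B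
      (\<lambda>x. decreasing_rearrangement (limit_freq x)) =
    distr (paint_space k) ?B (\<lambda>z. decreasing_rearrangement (limit_freq (paint_labels z)))"
    by (subst distr_distr[OF measurable_ranked_limit_freq labels]) (simp only: comp_def)
  also have "\<dots> = distr (paint_space k) ?B (\<lambda>z. decreasing_rearrangement (stick_breaking (fst z)))"
  proof (rule distr_cong_AE)
    show "AE z in paint_space k. decreasing_rearrangement (limit_freq (paint_labels z)) =
        decreasing_rearrangement (stick_breaking (fst z))"
      using AE_paint_labels[OF k] by (rule eventually_mono) simp
    show "(\<lambda>z. decreasing_rearrangement (stick_breaking (fst z))) \<in> paint_space k \<rightarrow>\<^sub>M ?B"
      by (rule measurable_compose[OF measurable_fst rearr])
    show "(\<lambda>z. decreasing_rearrangement (limit_freq (paint_labels z))) \<in> paint_space k \<rightarrow>\<^sub>M ?B"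
      by (rule measurable_compose[OF labels measurable_ranked_limit_freq])
  qed simp_all
  also have "\<dots> = distr (distr (paint_space k) (sticks k) fst) ?B (\<lambda>\<beta>. decreasing_rearrangement (stick_breaking \<beta>))"
    by (subst distr_distr[OF rearr measurable_fst]) (simp only: comp_def)
  also have "distr (paint_space k) (sticks k) fst = sticks k"
    by (rule U.distr_pair_fst)
  finally show ?thesis using k by (simp only: poisson_dirichlet_inverse)
qed

theorem theorem7p2:
  fixes k :: nat and M :: "'a measure"
    and G :: "nat \<Rightarrow> 'a \<Rightarrow> nat"
    and S :: "nat \<Rightarrow> 'a \<Rightarrow> nat list"
  assumes k: "k \<ge> 2"
    and M: "prob_space M"
    and gaps_indep: "prob_space.indep_vars M (\<lambda>_. count_space UNIV) G {1..}"
    and gaps_uniform: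
      "\<And>n. n \<ge> 1 \<Longrightarrow> distr M (count_space UNIV) (G n) = measure_pmf (pmf_of_set {0..k * n})"
    and start: "\<And>\<omega>. \<omega> \<in> space M \<Longrightarrow> S 1 \<omega> = replicate k 1"
    and step: "\<And>n \<omega>. n \<ge> 1 \<Longrightarrow> \<omega> \<in> space M \<Longrightarrow>
      S (Suc n) \<omega> = insert_string (G n \<omega>) (replicate k (Suc n)) (S n \<omega>)"
  shows "\<exists>V :: 'a \<Rightarrow> nat \<Rightarrow> real.
    V \<in> measurable M (\<Pi>\<^sub>M i\<in>UNIV. borel) \<and>
    distr M (\<Pi>\<^sub>M i\<in>UNIV. borel) V = poisson_dirichlet (1 / real k) (1 / real k) \<and>
    (AE \<omega> in M.
      (\<forall>i. (\<lambda>n. real (ranked_block_size (S n \<omega>) i) / real (k * n)) \<longlonglongrightarrow> V \<omega> i) \<and>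
      summable (V \<omega>) \<and>
      (\<lambda>n. \<Sum>i. \<bar>real (ranked_block_size (S n \<omega>) i) / real (k * n) - V \<omega> i\<bar>) \<longlonglongrightarrow> 0)"
proof -
  interpret prob_space M by (rule M)
  let ?P = "\<Pi>\<^sub>M m\<in>(UNIV :: nat set). count_space (UNIV :: nat set)"
  let ?B = "\<Pi>\<^sub>M i\<in>(UNIV :: nat set). (borel :: real measure)"
  have k0: "k > 0" using k by simp
  \<comment> \<open>\<open>G\<close> is indexed from 1, the label sequence from 0.\<close>
  define X where "X \<omega> = label_seq k (\<lambda>m. G (Suc m) \<omega>)" for \<omega>
  \<comment> \<open>A function of the labels alone, so that its law can be computed in the sampling
    model.\<close>
  define V where "V \<omega> = decreasing_rearrangement (limit_freq (X \<omega>))" for \<omega>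
  have label_law: "prob {\<omega> \<in> space M. \<forall>m<n. X \<omega> m = x m} = (\<Prod>m<n. label_prob k x m)" for n x
    unfolding X_def by (rule prob_label_seq(1)[OF k0 gaps_indep gaps_uniform])
  have gaps: "AE \<omega> in M. \<forall>m. G (Suc m) \<omega> \<le> k * Suc m"
    by (rule prob_label_seq(2)[OF k0 gaps_indep gaps_uniform])
  have X_component [measurable]: "(\<lambda>\<omega>. X \<omega> m) \<in> M \<rightarrow>\<^sub>M count_space UNIV" for m
    unfolding X_def using gaps_indep by (intro measurable_label_seq) (auto simp: indep_vars_def)
  have X [measurable]: "X \<in> M \<rightarrow>\<^sub>M ?P"
    by (rule measurable_PiM_single') (auto simp: space_PiM)
  have law: "distr M ?P X = distr (paint_space k) ?P paint_labels"
  proof (rule distr_eq_of_prefixes[OF M X_component measurable_paint_labels])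
    show "emeasure M {z \<in> space M. \<forall>m<n. X z m = x m} =
        emeasure (paint_space k) {z \<in> space (paint_space k). \<forall>m<n. paint_labels z m = x m}" for n x
      by (simp only: emeasure_paint_labels[OF k] emeasure_eq_measure label_law)
  qed
  have "distr M ?B V = distr (distr M ?P X) ?B (\<lambda>x. decreasing_rearrangement (limit_freq x))"
    unfolding V_def[abs_def] by (subst distr_distr[OF measurable_ranked_limit_freq X]) (simp only: comp_def)
  also have "\<dots> = poisson_dirichlet (1 / real k) (1 / real k)"
    unfolding law by (rule distr_paint_labels[OF k])
  finally have V_law: "distr M ?B V = poisson_dirichlet (1 / real k) (1 / real k)" .
  have "AE x in distr (paint_space k) ?P paint_labels. regular x"
  proof (subst AE_distr_iff)
    show "paint_labels \<in> paint_space k \<rightarrow>\<^sub>M ?P"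
      by (rule measurable_PiM_single') (auto simp: space_PiM)
    show "AE z in paint_space k. regular (paint_labels z)"
      using AE_paint_labels[OF k] by (rule eventually_mono) simp
  qed measurable
  then have regular: "AE \<omega> in M. regular (X \<omega>)"
    unfolding law[symmetric] by (rule AE_distrD[OF X])
  have S: "S (Suc n) \<omega> = stirling_word k (\<lambda>m. G (Suc m) \<omega>) n" if "\<omega> \<in> space M" for n \<omega>
  proof (induction n)
    case 0
    then show ?case using start[OF that] by simp
  next
    case (Suc n)
    then show ?case using step[OF _ that, of "Suc n"] by simp
  qed
  have "AE \<omega> in M. (\<forall>i. (\<lambda>n. real (ranked_block_size (S n \<omega>) i) / real (k * n)) \<longlonglongrightarrow> V \<omega> i) \<and>
      summable (V \<omega>) \<and>
      (\<lambda>n. \<Sum>i. \<bar>real (ranked_block_size (S n \<omega>) i) / real (k * n) - V \<omega> i\<bar>) \<longlonglongrightarrow> 0"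
    using regular gaps AE_space
  proof eventually_elim
    case (elim \<omega>)
    note reg = regularD[OF elim(1)]
    have ranked: "real (ranked_block_size (S (Suc n) \<omega>) i) / real (k * Suc n) =
        decreasing_rearrangement (label_freq (X \<omega>) n) i" for n i
      unfolding S[OF elim(3)] X_def using elim(2) by (intro ranked_block_size_stirling_word k0) simp
    note conv = decreasing_rearrangement_convergence[OF label_freq_nonneg label_freq_sums
        rearrangeable_label_freq less_imp_le[OF reg(2)] reg(3,4,1)]
    have "(\<lambda>n. real (ranked_block_size (S n \<omega>) i) / real (k * n)) \<longlonglongrightarrow> V \<omega> i" for i
      \<comment> \<open>Passing to \<open>Suc n\<close> drops index 0, at which \<open>S\<close> is
        not specified and the normalisation vanishes.\<close>
      by (rule LIMSEQ_imp_Suc) (unfold ranked V_def, rule conv(1))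
    moreover have "summable (V \<omega>)"
      unfolding V_def
      using decreasing_rearrangement_sums[OF reg(4) less_imp_le[OF reg(2)] reg(3)] by (simp add: sums_iff)
    moreover have "(\<lambda>n. \<Sum>i. \<bar>real (ranked_block_size (S n \<omega>) i) / real (k * n) - V \<omega> i\<bar>) \<longlonglongrightarrow> 0"
      by (rule LIMSEQ_imp_Suc) (unfold ranked V_def, rule conv(2))
    ultimately show ?case by blast
  qed
  moreover have "V \<in> M \<rightarrow>\<^sub>M ?B"
    unfolding V_def[abs_def] by (rule measurable_compose[OF X measurable_ranked_limit_freq])
  ultimately show ?thesis using V_law by blast
qed

end
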